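(* Let $H$ be a graded connected Hopf algebra over $\Bbbk$, with finite-dimensional homogeneous components $H_m$, that is cofree as a graded coalgebra, and let $S$ be its antipode. For any nonnegative integer $m$, $$\operatorname{trace}\bigl(S|_{H_m}\bigr)=\mathrm{epal}(m)-\mathrm{opal}(m)=\sum_{k=0}^m(-1)^k\,\mathrm{pal}(k,m).$$
   Context: $\Bbbk$ is a field of characteristic zero. A graded connected Hopf algebra is a bialgebra $H$ with product $\mu$, coproduct $\Delta$, unit $1$, counit $\varepsilon$ and a decomposition $H=\bigoplus_{m\ge 0}H_m$ such that $\mu(H_p\otimes H_q)\subseteq H_{p+q}$, $\Delta(H_m)\subseteq\bigoplus_{p+q=m}H_p\otimes H_q$, $1\in H_0$, $\varepsilon(H_m)=0$ for $m>0$, and $\dim H_0=1$. It automatically has an antipode $S$, which preserves each $H_m$. $H$ is cofree if, as a graded coalgebra, it is isomorphic to the deconcatenation coalgebra $\bigoplus_{k\ge0}V^{\otimes k}$ on a graded vector space $V$, with coproduct $\Delta(x_1\cdots x_k)=1\otimes(x_1\cdots x_k)+\sum_{i=1}^{k-1}(x_1\cdots x_i)\otimes(x_{i+1}\cdots x_k)+(x_1\cdots x_k)\otimes1$. Then $V\cong\mathcal P(H)=\{x\in H:\Delta(x)=1\otimes x+x\otimes1\}$ as graded vector spaces. Take $V=\mathcal P(H)$ and fix a homogeneous basis of $V$ as an alphabet; an element of degree $n$ is a letter of weight $n$, so there are $v_n=\dim V_n$ letters of weight $n$ ($n\ge1$). A word is a finite sequence of letters (the empty word included); its length is its number of letters and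 its weight is the sum of the weights of its letters. A palindrome is a word that coincides with its reversal. $\mathrm{pal}(k,m)$ denotes the number of palindromes of length $k$ and weight $m$; $\mathrm{epal}(m)$ and $\mathrm{opal}(m)$ denote the numbers of palindromes of weight $m$ of even and of odd length, respectively. *)

theory Defs
  imports Complex_Main "HOL-Library.Poly_Mapping"
begin

section \<open>Formal linear combinations and tensors\<close>

text \<open>
  \<open>'a \<Rightarrow>\<^sub>0 'k\<close> is the free vector space on the type \<open>'a\<close>.
\<close>

definition fscale :: "'k::field \<Rightarrow> ('a \<Rightarrow>\<^sub>0 'k) \<Rightarrow> ('a \<Rightarrow>\<^sub>0 'k)"
  where "fscale c p = Poly_Mapping.map ((*) c) p"

lemma lookup_fscale [simp]: "Poly_Mapping.lookup (fscale c p) a = c * Poly_Mapping.lookup p a"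
  by (simp add: fscale_def Poly_Mapping.map.rep_eq when_def)

interpretation formal: vector_space fscale
  by unfold_locales (auto intro!: poly_mapping_eqI simp: lookup_add algebra_simps)

definition linear_extension ::
    "('k::field \<Rightarrow> 'v::ab_group_add \<Rightarrow> 'v) \<Rightarrow> ('a \<Rightarrow> 'v) \<Rightarrow> ('a \<Rightarrow>\<^sub>0 'k) \<Rightarrow> 'v"
  where "linear_extension s f p = (\<Sum>a\<in>Poly_Mapping.keys p. s (Poly_Mapping.lookup p a) (f a))"

text \<open>
  The tensor algebra \<open>T(V) = (\<Oplus>k. V\<^sup>\<otimes>\<^sup>k)\<close> is the quotient of the free vector space on the
  lists over \<open>V\<close> by multilinearity, the list \<open>[x\<^sub>1, \<dots>, x\<^sub>k]\<close> standing for
  \<open>x\<^sub>1 \<otimes> \<cdots> \<otimes> x\<^sub>k\<close>. As the quotient depends on the scalar multiplication, it is not formed as a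
  type: its elements are handled through representatives, and equality of
  tensors is the congruence \<open>tensor_eq\<close>. The relations are homogeneous in the length of lists, so
  on lists of length \<open>k\<close> the congruence is equality in \<open>V\<^sup>\<otimes>\<^sup>k\<close>.
\<close>

definition pure_tensor :: "'v list \<Rightarrow> ('v list \<Rightarrow>\<^sub>0 'k::field)"
  where "pure_tensor w = Poly_Mapping.single w 1"

definition multilinear_relations ::
    "('k::field \<Rightarrow> 'v::ab_group_add \<Rightarrow> 'v) \<Rightarrow> ('v list \<Rightarrow>\<^sub>0 'k) set"
  where "multilinear_relations s =
    {pure_tensor (u @ [x + y] @ w) - (pure_tensor (u @ [x] @ w) + pure_tensor (u @ [y] @ w)) | u x y w. True} \<union>
    {pure_tensor (u @ [s c x] @ w) - fscale c (pure_tensor (u @ [x] @ w)) | u c x w. True}"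

definition tensor_eq ::
    "('k::field \<Rightarrow> 'v::ab_group_add \<Rightarrow> 'v) \<Rightarrow> ('v list \<Rightarrow>\<^sub>0 'k) \<Rightarrow> ('v list \<Rightarrow>\<^sub>0 'k) \<Rightarrow> bool"
  where "tensor_eq s p q \<longleftrightarrow> p - q \<in> formal.span (multilinear_relations s)"

text \<open>
  \<open>lift2 s \<beta>\<close> is the linear map on \<open>V \<otimes> V\<close> given by \<open>a \<otimes> b \<mapsto> \<beta> a b\<close>; here \<open>s\<close> is the scalar
  multiplication of the codomain. Lists of length other than two do not occur in elements of
  \<open>V \<otimes> V\<close>; they are sent to zero.
\<close>

definition lift2 ::
    "('k::field \<Rightarrow> 'w::ab_group_add \<Rightarrow> 'w) \<Rightarrow> ('v \<Rightarrow> 'v \<Rightarrow> 'w) \<Rightarrow> ('v list \<Rightarrow>\<^sub>0 'k) \<Rightarrow> 'w"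
  where "lift2 s \<beta> = linear_extension s (\<lambda>w. case w of [a, b] \<Rightarrow> \<beta> a b | _ \<Rightarrow> 0)"

definition tensor_mult ::
    "('h::ring_1 list \<Rightarrow>\<^sub>0 'k::field) \<Rightarrow> ('h list \<Rightarrow>\<^sub>0 'k) \<Rightarrow> ('h list \<Rightarrow>\<^sub>0 'k)"
  where "tensor_mult p q =
    lift2 fscale (\<lambda>a b. lift2 fscale (\<lambda>c d. pure_tensor [a * c, b * d]) q) p"


section \<open>Graded vector spaces\<close>

locale graded_vector_space = vector_space scale
  for scale :: "'k::field \<Rightarrow> 'v::ab_group_add \<Rightarrow> 'v" +
  fixes comp :: "nat \<Rightarrow> 'v set"
  assumes subspace_comp: "subspace (comp n)"
    and direct_sum: "\<exists>!c. finite {n. c n \<noteq> 0} \<and> (\<forall>n. c n \<in> comp n) \<and> x = (\<Sum>n | c n \<noteq> 0. c n)"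
begin

definition homogeneous_basis :: "'v set \<Rightarrow> 'v set \<Rightarrow> bool"
  where "homogeneous_basis W B \<longleftrightarrow> B \<subseteq> (\<Union>n. comp n) \<and> independent B \<and> span B = W"

definition finite_dim_components :: bool
  where "finite_dim_components \<longleftrightarrow> (\<forall>n. \<exists>B. finite B \<and> span B = comp n)"

text \<open>The component of degree \<open>m\<close> of the tensor algebra, for the total degree (up to \<open>tensor_eq\<close>).\<close>

definition tensor_comp :: "nat \<Rightarrow> ('v list \<Rightarrow>\<^sub>0 'k) set"
  where "tensor_comp m = formal.span
    {pure_tensor w | w. \<exists>ns. list_all2 (\<lambda>x n. x \<in> comp n) w ns \<and> sum_list ns = m}"

end

text \<open>
  Trace of the restriction of \<open>f\<close> to a finite-dimensional invariant subspace \<open>W\<close>. The value does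
  not depend on the basis of \<open>W\<close> that is chosen.
\<close>

definition (in vector_space) trace_on :: "'b set \<Rightarrow> ('b \<Rightarrow> 'b) \<Rightarrow> 'a"
  where "trace_on W f =
    (let B = (SOME B. independent B \<and> span B = W) in \<Sum>b\<in>B. representation B (f b) b)"


section \<open>Graded coalgebras and connected Hopf algebras\<close>

locale graded_coalgebra = graded_vector_space scale comp
  for scale :: "'k::field \<Rightarrow> 'h::ab_group_add \<Rightarrow> 'h" and comp :: "nat \<Rightarrow> 'h set" +
  fixes \<Delta> :: "'h \<Rightarrow> ('h list \<Rightarrow>\<^sub>0 'k)" and \<epsilon> :: "'h \<Rightarrow> 'k"
  assumes comult_tensor2: "Poly_Mapping.keys (\<Delta> x) \<subseteq> {w. length w = 2}"
    and comult_add: "tensor_eq scale (\<Delta> (x + y)) (\<Delta> x + \<Delta> y)"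
    and comult_scale: "tensor_eq scale (\<Delta> (scale c x)) (fscale c (\<Delta> x))"
    and counit_linear: "Vector_Spaces.linear scale (*) \<epsilon>"
    and coassoc: "tensor_eq scale
      (lift2 fscale (\<lambda>a b. lift2 fscale (\<lambda>c d. pure_tensor [c, d, b]) (\<Delta> a)) (\<Delta> x))
      (lift2 fscale (\<lambda>a b. lift2 fscale (\<lambda>c d. pure_tensor [a, c, d]) (\<Delta> b)) (\<Delta> x))"
    and counit_left: "lift2 scale (\<lambda>a b. scale (\<epsilon> a) b) (\<Delta> x) = x"
    and counit_right: "lift2 scale (\<lambda>a b. scale (\<epsilon> b) a) (\<Delta> x) = x"
    and comult_graded: "x \<in> comp m \<Longrightarrow>
      \<exists>p. tensor_eq scale (\<Delta> x) p \<and> Poly_Mapping.keys p \<subseteq> {[a, b] | a b i j. a \<in> comp i \<and> b \<in> comp j \<and> i + j = m}"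
    and counit_graded: "m > 0 \<Longrightarrow> x \<in> comp m \<Longrightarrow> \<epsilon> x = 0"

text \<open>The associative unital product is that of the class \<^class>\<open>ring_1\<close>.\<close>

locale graded_connected_hopf_algebra = graded_coalgebra scale comp \<Delta> \<epsilon>
  for scale :: "'k::field \<Rightarrow> 'h::ring_1 \<Rightarrow> 'h" and comp :: "nat \<Rightarrow> 'h set"
    and \<Delta> :: "'h \<Rightarrow> ('h list \<Rightarrow>\<^sub>0 'k)" and \<epsilon> :: "'h \<Rightarrow> 'k" +
  fixes S :: "'h \<Rightarrow> 'h"
  assumes scale_mult_left: "scale c x * y = scale c (x * y)"
    and scale_mult_right: "x * scale c y = scale c (x * y)"
    and mult_graded: "x \<in> comp p \<Longrightarrow> y \<in> comp q \<Longrightarrow> x * y \<in> comp (p + q)"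
    and one_graded: "1 \<in> comp 0"
    and connected: "dim (comp 0) = 1"
    and comult_mult: "tensor_eq scale (\<Delta> (x * y)) (tensor_mult (\<Delta> x) (\<Delta> y))"
    and comult_one: "tensor_eq scale (\<Delta> 1) (pure_tensor [1, 1])"
    and counit_mult: "\<epsilon> (x * y) = \<epsilon> x * \<epsilon> y"
    and counit_one: "\<epsilon> 1 = 1"
    and antipode_linear: "Vector_Spaces.linear scale scale S"
    and antipode_left: "lift2 scale (\<lambda>a b. S a * b) (\<Delta> x) = scale (\<epsilon> x) 1"
    and antipode_right: "lift2 scale (\<lambda>a b. a * S b) (\<Delta> x) = scale (\<epsilon> x) 1"
begin

definition primitives :: "'h set"
  where "primitives = {x. tensor_eq scale (\<Delta> x) (pure_tensor [1, x] + pure_tensor [x, 1])}"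

end


section \<open>Cofreeness\<close>

text \<open>
  Deconcatenation \<open>T(V) \<rightarrow> T(V) \<otimes> T(V)\<close> on representatives, the pair \<open>(u, v)\<close> standing for the
  tensor of the pure tensors \<open>u\<close> and \<open>v\<close>.
\<close>

definition deconcatenation :: "('v list \<Rightarrow>\<^sub>0 'k::field) \<Rightarrow> ('v list \<times> 'v list \<Rightarrow>\<^sub>0 'k)"
  where "deconcatenation = linear_extension fscale
    (\<lambda>w. \<Sum>i\<le>length w. Poly_Mapping.single (take i w, drop i w) 1)"

text \<open>
  \<open>\<Phi>\<close> is an isomorphism of graded coalgebras from \<open>T(V)\<close> to \<open>H\<close>, given on representatives. The
  second clause says that \<open>\<Phi>\<close> is well defined and injective on \<open>T(V)\<close>; the fourth is
  \<open>\<Delta> \<circ> \<Phi> = (\<Phi> \<otimes> \<Phi>) \<circ> deconcatenation\<close>; the fifth compares \<open>\<epsilon>\<close> with the projection of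
  \<open>T(V)\<close> onto \<open>V\<^sup>\<otimes>\<^sup>0 = k\<close>.
\<close>

definition (in graded_coalgebra) tensor_coalgebra_iso ::
    "('k \<Rightarrow> 'v::ab_group_add \<Rightarrow> 'v) \<Rightarrow> (nat \<Rightarrow> 'v set) \<Rightarrow> (('v list \<Rightarrow>\<^sub>0 'k) \<Rightarrow> 'h) \<Rightarrow> bool"
  where "tensor_coalgebra_iso scaleV compV \<Phi> \<longleftrightarrow>
    Vector_Spaces.linear fscale scale \<Phi> \<and>
    (\<forall>p q. \<Phi> p = \<Phi> q \<longleftrightarrow> tensor_eq scaleV p q) \<and>
    surj \<Phi> \<and>
    (\<forall>p. tensor_eq scale (\<Delta> (\<Phi> p))
      (linear_extension fscale (\<lambda>(u, v). pure_tensor [\<Phi> (pure_tensor u), \<Phi> (pure_tensor v)])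
        (deconcatenation p))) \<and>
    (\<forall>p. \<epsilon> (\<Phi> p) = Poly_Mapping.lookup p []) \<and>
    (\<forall>m. \<Phi> ` graded_vector_space.tensor_comp compV m = comp m)"

text \<open>
  \<open>H\<close> is cofree on \<open>V\<close>. As the definition cannot quantify over the carrier type of \<open>V\<close>, the graded
  space \<open>V\<close> is a parameter; a hypothesis \<open>cofree_on scaleV compV\<close> with \<open>V\<close> arbitrary amounts to
  cofreeness of \<open>H\<close>.
\<close>

definition (in graded_coalgebra) cofree_on ::
    "('k \<Rightarrow> 'v::ab_group_add \<Rightarrow> 'v) \<Rightarrow> (nat \<Rightarrow> 'v set) \<Rightarrow> bool"
  where "cofree_on scaleV compV \<longleftrightarrow>
    graded_vector_space scaleV compV \<and> (\<exists>\<Phi>. tensor_coalgebra_iso scaleV compV \<Phi>)"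


section \<open>Counting palindromes\<close>

text \<open>\<open>A\<close> is the alphabet and \<open>wt\<close> gives the weight of a letter.\<close>

definition palindromes :: "'a set \<Rightarrow> ('a \<Rightarrow> nat) \<Rightarrow> nat \<Rightarrow> 'a list set"
  where "palindromes A wt m = {w \<in> lists A. rev w = w \<and> sum_list (map wt w) = m}"

definition pal :: "'a set \<Rightarrow> ('a \<Rightarrow> nat) \<Rightarrow> nat \<Rightarrow> nat \<Rightarrow> nat"
  where "pal A wt k m = card {w \<in> palindromes A wt m. length w = k}"

definition epal :: "'a set \<Rightarrow> ('a \<Rightarrow> nat) \<Rightarrow> nat \<Rightarrow> nat"
  where "epal A wt m = card {w \<in> palindromes A wt m. even (length w)}"

definition opal :: "'a set \<Rightarrow> ('a \<Rightarrow> nat) \<Rightarrow> nat \<Rightarrow> nat"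
  where "opal A wt m = card {w \<in> palindromes A wt m. odd (length w)}"

end

theory Submission
  imports Defs
begin

text \<open>
  The reason for the trace formula is that, up to shorter words, the antipode of a cofree Hopf
  algebra reverses words and multiplies them by \<open>(-1)\<^sup>k\<close>, where \<open>k\<close> is the length. Filter \<open>H \<cong> T(V)\<close> by
  the length of words. The antipode preserves each \<open>H\<^sub>m\<close> and, modulo words of smaller length,
  \<open>S(x\<^sub>1 \<cdots> x\<^sub>k) = (-1)\<^sup>k x\<^sub>k \<cdots> x\<^sub>1\<close>. In a basis of words of weight \<open>m\<close> the diagonal
  entry of \<open>S\<close> at \<open>w\<close> is therefore \<open>(-1)\<^sup>k\<close> if \<open>w\<close> is a palindrome and zero otherwise.

  The leading term of \<open>S\<close> depends on only three facts. The antipode reverses coproducts,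
  \<open>\<Delta> \<circ> S = \<tau> \<circ> (S \<otimes> S) \<circ> \<Delta>\<close> with \<open>\<tau>\<close> the exchange of factors (\<open>conv_antipode\<close>); it negates primitive
  elements; and it fixes \<open>1\<close>. A coefficient of \<open>S(x\<^sub>1 \<cdots> x\<^sub>k)\<close> at a word with \<open>k\<close> letters is read off
  from its iterated coproduct by applying to each tensor factor the coordinate of one letter.
  Reversing the coproduct turns this into a sum over the ways of cutting \<open>x\<^sub>1 \<cdots> x\<^sub>k\<close> into \<open>k\<close>
  pieces. Empty pieces contribute zero, because \<open>1\<close> has no coordinate on a letter. So every piece is
  a single letter (\<open>coord_antipode_word\<close>). In this way the product of two words
  never has to be computed.

  All identities in \<open>H \<otimes> H\<close> are tested against pairs of linear functionals. This turns the coproduct into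
  the convolution product \<open>conv\<close> on the dual of \<open>H\<close>, for which the functionals \<open>coord\<close> multiply by
  concatenation. Finally, the prescribed alphabet of primitive elements is identified with a
  homogeneous basis of \<open>V\<close>: the primitive elements are exactly the words with one letter
  (\<open>primitive_is_letter\<close>), and the isomorphism \<open>\<Phi>\<close> preserves degrees.
\<close>

section \<open>Linear algebra: trace and dual families\<close>

context vector_space
begin

text \<open>
  Words over an alphabet will be shown to be linearly independent by exhibiting functionals dual to
  them; the same functionals then compute the coefficients of an expansion.
\<close>

lemma representation_dual_family:
  assumes lin: "\<And>i. i \<in> I \<Longrightarrow> Vector_Spaces.linear scale (*) (c i)"
    and dual: "\<And>i j. i \<in> I \<Longrightarrow> j \<in> I \<Longrightarrow> c i (b j) = (if i = j then 1 else 0)"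
  shows "inj_on b I" and "independent (b ` I)"
    and "x \<in> span (b ` I) \<Longrightarrow> i \<in> I \<Longrightarrow> representation (b ` I) x (b i) = c i x"
proof -
  show inj: "inj_on b I"
    by (rule inj_onI) (metis dual zero_neq_one)
  show ind: "independent (b ` I)"
    unfolding independent_explicit_module
  proof (intro allI impI)
    fix T u y assume *: "finite T" "T \<subseteq> b ` I" "(\<Sum>v\<in>T. scale (u v) v) = 0" "y \<in> T"
    then obtain i where i: "i \<in> I" "y = b i" by blast
    interpret ci: Vector_Spaces.linear scale "(*)" "c i" by (rule lin) fact
    have "0 = c i (\<Sum>v\<in>T. scale (u v) v)" using * by simp
    also have "\<dots> = (\<Sum>v\<in>T. u v * c i v)" by (simp add: ci.sum ci.scale)
    also have "\<dots> = (\<Sum>v\<in>T. if v = y then u v else 0)"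
    proof (rule sum.cong[OF refl])
      fix v assume "v \<in> T"
      then obtain j where "j \<in> I" "v = b j" using * by blast
      then show "u v * c i v = (if v = y then u v else 0)"
        using i inj dual[of i j] by (auto simp: inj_on_eq_iff)
    qed
    also have "\<dots> = u y" using * by simp
    finally show "u y = 0" by simp
  qed
  assume x: "x \<in> span (b ` I)" and i: "i \<in> I"
  interpret ci: Vector_Spaces.linear scale "(*)" "c i" by (rule lin) fact
  have "x \<in> span (b ` I) \<and> representation (b ` I) x (b i) = c i x"
    using x
  proof (induction rule: span_induct_alt)
    case base
    then show ?case by (simp add: representation_zero span_zero)
  next
    case (step a y z)
    then obtain j where j: "j \<in> I" "y = b j" by blast
    have "representation (b ` I) (scale a y + z) (b i)
        = a * representation (b ` I) y (b i) + representation (b ` I) z (b i)"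
      using ind step by (simp add: representation_add representation_scale span_base span_scale)
    also have "representation (b ` I) y (b i) = c i y"
      using ind j i inj dual[of i j] by (auto simp: representation_basis inj_on_eq_iff)
    finally show ?case using step by (simp add: ci.add ci.scale span_add span_scale span_base)
  qed
  then show "representation (b ` I) x (b i) = c i x" ..
qed

text \<open>
  Both diagonal sums equal \<open>\<Sum>b\<in>B. \<Sum>c\<in>C. P c b * Q b c\<close>, where \<open>P\<close> expresses the vectors of \<open>B\<close> in
  \<open>C\<close> and \<open>Q\<close> expresses the images of the vectors of \<open>C\<close> in \<open>B\<close>.
\<close>

lemma sum_representation_basis_independent:
  assumes B: "independent B" "finite B" and C: "independent C" "finite C"
    and span_eq: "span B = span C"
    and f: "Vector_Spaces.linear scale scale f"
    and inv: "\<And>x. x \<in> span B \<Longrightarrow> f x \<in> span B"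
  shows "(\<Sum>b\<in>B. representation B (f b) b) = (\<Sum>c\<in>C. representation C (f c) c)"
proof -
  interpret f: Vector_Spaces.linear scale scale f by fact
  have "(\<Sum>b\<in>B. representation B (f b) b)
      = (\<Sum>b\<in>B. \<Sum>c\<in>C. representation C b c * representation B (f c) b)"
  proof (rule sum.cong[OF refl])
    fix b assume b: "b \<in> B"
    then have bC: "b \<in> span C" using span_eq span_base by blast
    have "f b = f (\<Sum>c\<in>C. scale (representation C b c) c)"
      using C bC by (simp add: sum_representation_eq)
    also have "\<dots> = (\<Sum>c\<in>C. scale (representation C b c) (f c))"
      by (simp add: f.sum f.scale)
    finally show "representation B (f b) b = (\<Sum>c\<in>C. representation C b c * representation B (f c) b)"
      using B inv span_eq
      by (simp add: representation_sum representation_scale span_base span_scale)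
  qed
  also have "\<dots> = (\<Sum>c\<in>C. \<Sum>b\<in>B. representation C b c * representation B (f c) b)"
    by (rule sum.swap)
  also have "\<dots> = (\<Sum>c\<in>C. representation C (f c) c)"
  proof (rule sum.cong[OF refl])
    fix c assume c: "c \<in> C"
    then have fc: "f c \<in> span B" using inv span_eq span_base by blast
    have BC: "b \<in> span C" if "b \<in> B" for b using that span_eq span_base by blast
    have "f c = (\<Sum>b\<in>B. scale (representation B (f c) b) b)"
      using B fc by (simp add: sum_representation_eq)
    then have "representation C (f c) c
        = representation C (\<Sum>b\<in>B. scale (representation B (f c) b) b) c" by simp
    also have "\<dots> = (\<Sum>b\<in>B. representation B (f c) b * representation C b c)"
      using C BC by (simp add: representation_sum representation_scale span_scale)
    finally show "(\<Sum>b\<in>B. representation C b c * representation B (f c) b) = representation C (f c) c"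
      by (simp add: mult.commute)
  qed
  finally show ?thesis .
qed

lemma trace_on_eq_sum_representation:
  assumes "independent B" "finite B" "span B = W"
    and "Vector_Spaces.linear scale scale f" "\<And>x. x \<in> W \<Longrightarrow> f x \<in> W"
  shows "trace_on W f = (\<Sum>b\<in>B. representation B (f b) b)"
proof -
  define C where "C = (SOME C. independent C \<and> span C = W)"
  have C: "independent C \<and> span C = W"
    unfolding C_def using assms(1,3) by (intro someI[of "\<lambda>C. independent C \<and> span C = W" B]) simp
  moreover have "finite C"
    using independent_span_bound[OF \<open>finite B\<close>, of C] C assms(3) span_superset[of C] by simp
  ultimately have "(\<Sum>b\<in>C. representation C (f b) b) = (\<Sum>b\<in>B. representation B (f b) b)"
    by (intro sum_representation_basis_independent) (use C assms in simp_all)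
  then show ?thesis by (simp add: trace_on_def C_def Let_def)
qed

end

lemma (in graded_vector_space) homogeneous_sum_component:
  assumes fin: "finite N" and f: "\<And>n. n \<in> N \<Longrightarrow> f n \<in> comp n"
    and x: "x \<in> comp m" "x = (\<Sum>n\<in>N. f n)"
  shows "x = (if m \<in> N then f m else 0)"
proof -
  let ?P = "\<lambda>c. finite {n. c n \<noteq> 0} \<and> (\<forall>n. c n \<in> comp n) \<and> x = (\<Sum>n | c n \<noteq> 0. c n)"
  define c where "c n = (if n \<in> N then f n else 0)" for n
  define d where "d n = (if n = m then x else 0)" for n
  have zero: "0 \<in> comp n" for n using subspace_comp subspace_0 by blast
  have "{n. c n \<noteq> 0} \<subseteq> N" by (auto simp: c_def)
  then have "?P c"
    using assms zero by (auto simp: c_def finite_subset intro!: sum.mono_neutral_cong_right)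
  moreover have "{n. d n \<noteq> 0} \<subseteq> {m}" by (auto simp: d_def)
  moreover have "?P d"
  proof (cases "x = 0")
    case True
    then show ?thesis using zero by (simp add: d_def)
  next
    case False
    then have "{n. d n \<noteq> 0} = {m}" by (auto simp: d_def)
    then show ?thesis using x(1) zero by (simp add: d_def)
  qed
  ultimately have "c = d" using direct_sum[of x] by blast
  then have "c m = d m" by simp
  then show ?thesis by (simp add: c_def d_def)
qed

section \<open>Linear maps out of formal tensors\<close>

lemma vector_space_field: "vector_space ((*) :: 'k::field \<Rightarrow> 'k \<Rightarrow> 'k)"
  by unfold_locales (auto simp: algebra_simps)

lemma linear_extension_superset:
  assumes "vector_space s" "finite T" "Poly_Mapping.keys p \<subseteq> T"
  shows "linear_extension s f p = (\<Sum>a\<in>T. s (Poly_Mapping.lookup p a) (f a))"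
proof -
  interpret vector_space s by fact
  show ?thesis
    unfolding linear_extension_def using assms
    by (intro sum.mono_neutral_left) (auto simp: in_keys_iff)
qed

lemma linear_linear_extension:
  fixes s :: "'k::field \<Rightarrow> 'v::ab_group_add \<Rightarrow> 'v" and f :: "'a \<Rightarrow> 'v"
  assumes "vector_space s"
  shows "Vector_Spaces.linear fscale s (linear_extension s f)"
proof -
  interpret vector_space s by fact
  show ?thesis
    unfolding Vector_Spaces.linear_iff
  proof (intro conjI allI assms formal.vector_space_axioms)
    fix p q :: "'a \<Rightarrow>\<^sub>0 'k"
    let ?T = "Poly_Mapping.keys p \<union> Poly_Mapping.keys q"
    have "linear_extension s f r = (\<Sum>a\<in>?T. s (Poly_Mapping.lookup r a) (f a))"
      if "Poly_Mapping.keys r \<subseteq> ?T" for r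
      using that assms by (intro linear_extension_superset) auto
    then show "linear_extension s f (p + q) = linear_extension s f p + linear_extension s f q"
      using keys_add[of p q]
      by (auto simp: lookup_add scale_left_distrib sum.distrib)
  next
    fix c and p :: "'a \<Rightarrow>\<^sub>0 'k"
    have "Poly_Mapping.keys (fscale c p) \<subseteq> Poly_Mapping.keys p" by (auto simp: in_keys_iff)
    then have "linear_extension s f (fscale c p)
        = (\<Sum>a\<in>Poly_Mapping.keys p. s (c * Poly_Mapping.lookup p a) (f a))"
      using assms by (subst linear_extension_superset[of s "Poly_Mapping.keys p"]) auto
    then show "linear_extension s f (fscale c p) = s c (linear_extension s f p)"
      by (simp add: linear_extension_def scale_sum_right)
  qed
qed

lemma linear_extension_single [simp]:
  assumes "vector_space s"
  shows "linear_extension s f (Poly_Mapping.single a c) = s c (f a)"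
proof -
  interpret vector_space s by fact
  show ?thesis using assms by (subst linear_extension_superset[of s "{a}"]) auto
qed

lemma poly_mapping_eq_sum_single:
  "p = (\<Sum>a\<in>Poly_Mapping.keys p. fscale (Poly_Mapping.lookup p a) (Poly_Mapping.single a 1))"
  by (rule poly_mapping_eqI)
    (auto simp: lookup_sum lookup_single when_def in_keys_iff sum.delta' if_distrib cong: if_cong)

lemma linear_comp_linear_extension:
  assumes "Vector_Spaces.linear s t L"
  shows "L (linear_extension s f p) = linear_extension t (\<lambda>a. L (f a)) p"
proof -
  interpret Vector_Spaces.linear s t L by fact
  show ?thesis by (simp add: linear_extension_def sum scale)
qed

lemma linear_eq_linear_extension:
  assumes "Vector_Spaces.linear fscale s L"
  shows "L p = linear_extension s (\<lambda>a. L (Poly_Mapping.single a 1)) p"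
proof -
  interpret Vector_Spaces.linear fscale s L by fact
  show ?thesis by (subst poly_mapping_eq_sum_single) (simp add: linear_extension_def sum scale)
qed

definition multilinear ::
    "('k::field \<Rightarrow> 'v::ab_group_add \<Rightarrow> 'v) \<Rightarrow> ('k \<Rightarrow> 'w::ab_group_add \<Rightarrow> 'w) \<Rightarrow> ('v list \<Rightarrow> 'w) \<Rightarrow> bool"
  where "multilinear s t f \<longleftrightarrow>
    (\<forall>u x y w. f (u @ [x + y] @ w) = f (u @ [x] @ w) + f (u @ [y] @ w)) \<and>
    (\<forall>u c x w. f (u @ [s c x] @ w) = t c (f (u @ [x] @ w)))"

text \<open>
  The universal property of the tensor algebra: a map on lists gives a well-defined linear map on
  tensors as soon as it is multilinear, since its extension then kills the defining relations.
\<close>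

lemma linear_extension_tensor_eq:
  assumes t: "vector_space t" and f: "multilinear s t f" and eq: "tensor_eq s p q"
  shows "linear_extension t f p = linear_extension t f q"
proof -
  interpret vector_space t by fact
  interpret L: Vector_Spaces.linear fscale t "linear_extension t f" by (rule linear_linear_extension) fact
  have "linear_extension t f (p - q) = 0"
  proof (rule L.eq_0_on_span)
    show "p - q \<in> formal.span (multilinear_relations s)" using eq by (simp add: tensor_eq_def)
    fix r assume "r \<in> multilinear_relations s"
    then show "linear_extension t f r = 0"
      using f t by (auto simp: multilinear_relations_def multilinear_def pure_tensor_def
          L.diff L.add L.scale)
  qed
  then show ?thesis by (simp add: L.diff)
qed

definition bilinear_map ::
    "('k::field \<Rightarrow> 'v::ab_group_add \<Rightarrow> 'v) \<Rightarrow> ('k \<Rightarrow> 'w::ab_group_add \<Rightarrow> 'w) \<Rightarrow> ('v \<Rightarrow> 'v \<Rightarrow> 'w) \<Rightarrow> bool"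
  where "bilinear_map s t \<beta> \<longleftrightarrow>
    (\<forall>a b c. \<beta> (a + b) c = \<beta> a c + \<beta> b c) \<and> (\<forall>a b c. \<beta> a (b + c) = \<beta> a b + \<beta> a c) \<and>
    (\<forall>k a b. \<beta> (s k a) b = t k (\<beta> a b)) \<and> (\<forall>k a b. \<beta> a (s k b) = t k (\<beta> a b))"

lemma multilinear_bilinear_map:
  assumes "vector_space t" "bilinear_map s t \<beta>"
  shows "multilinear s t (\<lambda>w. case w of [a, b] \<Rightarrow> \<beta> a b | _ \<Rightarrow> 0)"
proof -
  interpret vector_space t by fact
  show ?thesis
    using assms(2) unfolding multilinear_def bilinear_map_def
    by (auto simp: Cons_eq_append_conv append_eq_Cons_conv split: list.splits)
qed

lemma lift2_tensor_eq:
  assumes "vector_space t" "bilinear_map s t \<beta>" "tensor_eq s p q"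
  shows "lift2 t \<beta> p = lift2 t \<beta> q"
  unfolding lift2_def using assms multilinear_bilinear_map linear_extension_tensor_eq by blast

lemma linear_lift2:
  assumes "vector_space t"
  shows "Vector_Spaces.linear fscale t (lift2 t \<beta>)"
  unfolding lift2_def using assms by (rule linear_linear_extension)

lemma lift2_pure_tensor [simp]:
  assumes "vector_space t"
  shows "lift2 t \<beta> (pure_tensor [a, b]) = \<beta> a b"
proof -
  interpret vector_space t by fact
  show ?thesis using assms by (simp add: lift2_def pure_tensor_def)
qed

lemma linear_comp_lift2:
  assumes "Vector_Spaces.linear s t L"
  shows "L (lift2 s \<beta> p) = lift2 t (\<lambda>a b. L (\<beta> a b)) p"
proof -
  interpret Vector_Spaces.linear s t L by fact
  show ?thesis
    unfolding lift2_def linear_comp_linear_extension[OF assms]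
    by (rule arg_cong2[where f = "linear_extension t"]) (auto split: list.splits)
qed

text \<open>
  Cancelling inside one tensor factor, as in the proof that the antipode reverses coproducts, uses
  linearity in a parameter of the bilinear map while the tensor is kept fixed.
\<close>

lemma linear_lift2_parameter:
  assumes s: "vector_space s" and t: "vector_space t"
    and \<gamma>: "\<And>a b. Vector_Spaces.linear s t (\<lambda>z. \<gamma> z a b)"
  shows "Vector_Spaces.linear s t (\<lambda>z. lift2 t (\<gamma> z) p)"
proof -
  interpret t: vector_space t by fact
  interpret p: vector_space_pair s t by (intro vector_space_pair.intro s t)
  have "Vector_Spaces.linear s t (\<lambda>z. case w of [a, b] \<Rightarrow> \<gamma> z a b | _ \<Rightarrow> 0)" for w
    using \<gamma> p.linear_zero
    by (cases w; cases "tl w"; cases "tl (tl w)") auto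
  then show ?thesis
    unfolding lift2_def linear_extension_def
    by (intro p.linear_compose_sum p.linear_compose_scale_right ballI)
qed

section \<open>Sums over the splittings of a word\<close>

text \<open>
  On words the coproduct is the sum over all splittings into a prefix and a suffix. With
  \<open>split_sum\<close>, Sweedler calculations become manipulations of nested finite sums:
  coassociativity is \<open>split_sum_assoc\<close>, and the counit axioms are
  \<open>split_sum_left_Nil\<close> and \<open>split_sum_right_Nil\<close>.
\<close>

definition split_sum :: "('a list \<Rightarrow> 'a list \<Rightarrow> 'b::comm_monoid_add) \<Rightarrow> 'a list \<Rightarrow> 'b"
  where "split_sum G w = (\<Sum>i\<le>length w. G (take i w) (drop i w))"

lemma split_sum_Nil [simp]: "split_sum G [] = G [] []"
  by (simp add: split_sum_def)

lemma split_sum_Cons: "split_sum G (x # w) = G [] (x # w) + split_sum (\<lambda>p. G (x # p)) w"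
  by (simp add: split_sum_def sum.atMost_Suc_shift del: sum.atMost_Suc)

lemma split_sum_snoc: "split_sum G (w @ [x]) = split_sum (\<lambda>p q. G p (q @ [x])) w + G (w @ [x]) []"
  by (simp add: split_sum_def)

lemma split_sum_cong:
  "(\<And>p q. w = p @ q \<Longrightarrow> G p q = G' p q) \<Longrightarrow> split_sum G w = split_sum G' w"
  by (simp add: split_sum_def)

lemma split_sum_map: "split_sum G (map f w) = split_sum (\<lambda>p q. G (map f p) (map f q)) w"
  by (simp add: split_sum_def take_map drop_map)

lemma split_sum_add:
  "split_sum (\<lambda>p q. G p q + G' p q) w = split_sum G w + split_sum G' w"
  by (simp add: split_sum_def sum.distrib)

lemma split_sum_assoc:
  "split_sum (\<lambda>p q. split_sum (G p) q) w = split_sum (\<lambda>p s. split_sum (\<lambda>q r. G q r s) p) w"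
  by (induction w arbitrary: G) (simp_all add: split_sum_Cons split_sum_add add.assoc)

lemma split_sum_zero [simp]: "split_sum (\<lambda>p q. 0) w = 0"
  by (simp add: split_sum_def)

lemma split_sum_left_Nil: "split_sum (\<lambda>p q. if p = [] then G q else 0) w = G w"
  by (cases w) (simp_all add: split_sum_Cons)

lemma split_sum_right_Nil: "split_sum (\<lambda>p q. if q = [] then G p else 0) w = G w"
  by (cases w rule: rev_cases) (simp_all add: split_sum_snoc)

lemma split_sum_swap:
  "split_sum (\<lambda>p q. split_sum (\<lambda>r s. G p q r s) v) u = split_sum (\<lambda>r s. split_sum (\<lambda>p q. G p q r s) u) v"
  unfolding split_sum_def by (rule sum.swap)

lemma linear_split_sum:
  assumes "Vector_Spaces.linear s t L"
  shows "L (split_sum G w) = split_sum (\<lambda>p q. L (G p q)) w"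
proof -
  interpret Vector_Spaces.linear s t L by fact
  show ?thesis by (simp add: split_sum_def sum)
qed

lemma lift2_split_sum:
  assumes "vector_space t"
  shows "lift2 t (\<lambda>a b. split_sum (G a b) w) p = split_sum (\<lambda>u v. lift2 t (\<lambda>a b. G a b u v) p) w"
proof -
  interpret vector_space t by fact
  have "(case x of [a, b] \<Rightarrow> split_sum (G a b) w | _ \<Rightarrow> 0)
      = split_sum (\<lambda>u v. case x of [a, b] \<Rightarrow> G a b u v | _ \<Rightarrow> 0) w" for x
    by (auto split: list.split)
  then show ?thesis
    unfolding lift2_def linear_extension_def
    by (simp add: split_sum_def scale_sum_right sum.swap[of _ _ "Poly_Mapping.keys p"])
qed

text \<open>
  \<open>tensor_functional [\<phi>\<^sub>1, \<dots>, \<phi>\<^sub>k]\<close> is the functional \<open>\<phi>\<^sub>1 \<otimes> \<cdots> \<otimes> \<phi>\<^sub>k\<close> on \<open>V\<^sup>\<otimes>\<^sup>k\<close>,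
  extended by zero to the other tensor powers.
\<close>

fun tensor_functional :: "('v \<Rightarrow> 'k::field) list \<Rightarrow> 'v list \<Rightarrow> 'k" where
  "tensor_functional [] [] = 1"
| "tensor_functional (\<phi> # \<phi>s) (x # xs) = \<phi> x * tensor_functional \<phi>s xs"
| "tensor_functional _ _ = 0"

lemma tensor_functional_length:
  "length \<phi>s \<noteq> length w \<Longrightarrow> tensor_functional \<phi>s w = 0"
  by (induction \<phi>s w rule: tensor_functional.induct) auto

text \<open>
  Concatenation of functionals is dual to deconcatenation: the only splitting that contributes cuts
  the word after \<open>length \<phi>s\<close> letters.
\<close>

lemma tensor_functional_append:
  "tensor_functional (\<phi>s @ \<psi>s) w
    = split_sum (\<lambda>p q. tensor_functional \<phi>s p * tensor_functional \<psi>s q) w"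
proof (induction \<phi>s arbitrary: w)
  case Nil
  have "split_sum (\<lambda>p q. tensor_functional [] p * tensor_functional \<psi>s q) w
      = split_sum (\<lambda>p q. if p = [] then tensor_functional \<psi>s q else 0) w"
    by (rule split_sum_cong) (auto simp: neq_Nil_conv)
  then show ?case by (simp add: split_sum_left_Nil)
next
  case (Cons \<phi> \<phi>s)
  show ?case
  proof (cases w)
    case (Cons x w')
    have "split_sum (\<lambda>p q. \<phi> x * tensor_functional \<phi>s p * tensor_functional \<psi>s q) w'
        = \<phi> x * split_sum (\<lambda>p q. tensor_functional \<phi>s p * tensor_functional \<psi>s q) w'"
      by (simp add: split_sum_def sum_distrib_left mult.assoc)
    then show ?thesis using Cons.IH Cons by (simp add: split_sum_Cons)
  qed simp
qed

lemma tensor_functional_snoc: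
  "tensor_functional (\<phi>s @ [\<phi>]) (w @ [x]) = tensor_functional \<phi>s w * \<phi> x"
proof (induction \<phi>s w rule: tensor_functional.induct)
  case ("3_1" v va)
  then show ?case by (cases va) auto
next
  case ("3_2" v va)
  then show ?case by (cases va) auto
qed auto

lemma multilinear_tensor_functional:
  assumes "\<forall>\<phi>\<in>set \<phi>s. Vector_Spaces.linear s (*) \<phi>"
  shows "multilinear s (*) (tensor_functional \<phi>s)"
  unfolding multilinear_def
proof (intro conjI allI)
  show "tensor_functional \<phi>s (u @ [x + y] @ w)
      = tensor_functional \<phi>s (u @ [x] @ w) + tensor_functional \<phi>s (u @ [y] @ w)" for u x y w
    using assms
  proof (induction u arbitrary: \<phi>s)
    case Nil
    then show ?case by (cases \<phi>s) (auto simp: Vector_Spaces.linear_iff algebra_simps)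
  next
    case (Cons z u)
    then show ?case by (cases \<phi>s) (auto simp: algebra_simps)
  qed
  show "tensor_functional \<phi>s (u @ [s c x] @ w) = c * tensor_functional \<phi>s (u @ [x] @ w)" for u c x w
    using assms
  proof (induction u arbitrary: \<phi>s)
    case Nil
    then show ?case by (cases \<phi>s) (auto simp: Vector_Spaces.linear_iff algebra_simps)
  next
    case (Cons z u)
    then show ?case by (cases \<phi>s) (auto simp: algebra_simps)
  qed
qed

lemma tensor_functional_map:
  assumes dual: "\<And>a b. a \<in> A \<Longrightarrow> b \<in> A \<Longrightarrow> \<phi> a (v b) = (if a = b then 1 else 0)"
    and "u \<in> lists A" "w \<in> lists A"
  shows "tensor_functional (map \<phi> u) (map v w) = (if u = w then 1 else 0)"
  using assms(2,3)
proof (induction u arbitrary: w)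
  case Nil
  then show ?case by (cases w) auto
next
  case (Cons a u)
  then show ?case by (cases w) (auto simp: dual)
qed

section \<open>Cofree Hopf algebras and the dual convolution\<close>

text \<open>
  A coalgebra isomorphism \<open>\<Phi>\<close> is fixed once and for all. The product of \<open>H\<close> is not related to
  concatenation by \<open>\<Phi>\<close>; only the coproduct is known on words.
\<close>

locale cofree_hopf_algebra =
  graded_connected_hopf_algebra scale comp \<Delta> \<epsilon> S + V: graded_vector_space scaleV compV
  for scale :: "'k::field \<Rightarrow> 'h::ring_1 \<Rightarrow> 'h" and comp :: "nat \<Rightarrow> 'h set"
    and \<Delta> :: "'h \<Rightarrow> ('h list \<Rightarrow>\<^sub>0 'k)" and \<epsilon> :: "'h \<Rightarrow> 'k" and S :: "'h \<Rightarrow> 'h"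
    and scaleV :: "'k \<Rightarrow> 'v::ab_group_add \<Rightarrow> 'v" and compV :: "nat \<Rightarrow> 'v set" +
  fixes \<Phi> :: "('v list \<Rightarrow>\<^sub>0 'k) \<Rightarrow> 'h"
  assumes iso: "tensor_coalgebra_iso scaleV compV \<Phi>"
begin

abbreviation functional :: "('h \<Rightarrow> 'k) \<Rightarrow> bool"
  where "functional f \<equiv> Vector_Spaces.linear scale (*) f"

definition word :: "'v list \<Rightarrow> 'h"
  where "word w = \<Phi> (pure_tensor w)"

sublocale Phi: Vector_Spaces.linear fscale scale \<Phi>
  using iso by (simp add: tensor_coalgebra_iso_def)

sublocale antipode: Vector_Spaces.linear scale scale S
  by (rule antipode_linear)

lemma functional_add: "functional f \<Longrightarrow> f (x + y) = f x + f y"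
  and functional_scale: "functional f \<Longrightarrow> f (scale c x) = c * f x"
  by (simp_all add: Vector_Spaces.linear_iff)

lemma functional_zero: "functional f \<Longrightarrow> f 0 = 0"
  using functional_scale[of f 0 0] by simp

lemma obtain_tensor: obtains p where "x = \<Phi> p"
  using iso unfolding tensor_coalgebra_iso_def surj_def by blast

text \<open>
  The images of the pure tensors span \<open>H\<close>, so identities between linear maps need only be checked
  on words, where the coproduct is explicit.
\<close>

lemma linear_eq_on_words:
  assumes L: "Vector_Spaces.linear scale t L" and L': "Vector_Spaces.linear scale t L'"
    and eq: "\<And>w. L (word w) = L' (word w)"
  shows "L x = L' x"
proof -
  obtain p where p: "x = \<Phi> p" by (rule obtain_tensor)
  have expand: "K x = linear_extension t (\<lambda>w. K (word w)) p"
    if "Vector_Spaces.linear scale t K" for K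
    using linear_eq_linear_extension[OF Vector_Spaces.linear_compose[OF Phi.linear_axioms that], of p]
    by (simp add: p word_def pure_tensor_def)
  show ?thesis using expand[OF L] expand[OF L'] by (simp add: eq)
qed

lemma deconcatenation_pure_tensor:
  "deconcatenation (pure_tensor w) = (\<Sum>i\<le>length w. Poly_Mapping.single (take i w, drop i w) 1)"
  by (simp add: deconcatenation_def pure_tensor_def formal.vector_space_axioms)

lemma comult_word:
  "tensor_eq scale (\<Delta> (word w)) (split_sum (\<lambda>p q. pure_tensor [word p, word q]) w)"
proof -
  let ?f = "\<lambda>(u, v). pure_tensor [\<Phi> (pure_tensor u), \<Phi> (pure_tensor v)]"
  interpret L: Vector_Spaces.linear fscale fscale "linear_extension fscale ?f"
    by (rule linear_linear_extension) (rule formal.vector_space_axioms)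
  have "tensor_eq scale (\<Delta> (word w)) (linear_extension fscale ?f (deconcatenation (pure_tensor w)))"
    using iso unfolding tensor_coalgebra_iso_def word_def by blast
  then show ?thesis
    by (simp add: deconcatenation_pure_tensor L.sum formal.vector_space_axioms split_sum_def word_def)
qed

lemma lift2_comult_word:
  assumes t: "vector_space t" and \<gamma>: "bilinear_map scale t \<gamma>"
  shows "lift2 t \<gamma> (\<Delta> (word w)) = split_sum (\<lambda>p q. \<gamma> (word p) (word q)) w"
proof -
  have "lift2 t \<gamma> (\<Delta> (word w)) = lift2 t \<gamma> (split_sum (\<lambda>p q. pure_tensor [word p, word q]) w)"
    using t \<gamma> comult_word by (rule lift2_tensor_eq)
  also have "\<dots> = split_sum (\<lambda>p q. \<gamma> (word p) (word q)) w"
    using t by (simp add: linear_split_sum[OF linear_lift2])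
  finally show ?thesis .
qed

lemma linear_lift2_of_comult:
  assumes t: "vector_space t" and \<gamma>: "bilinear_map scale t \<gamma>"
  shows "Vector_Spaces.linear scale t (\<lambda>x. lift2 t \<gamma> (\<Delta> x))"
proof -
  interpret L: Vector_Spaces.linear fscale t "lift2 t \<gamma>" by (rule linear_lift2) fact
  show ?thesis
    using lift2_tensor_eq[OF t \<gamma> comult_add] lift2_tensor_eq[OF t \<gamma> comult_scale]
    by (simp add: Vector_Spaces.linear_iff t vector_space_axioms L.add L.scale)
qed

lemma lift2_comult_mult:
  assumes t: "vector_space t" and \<gamma>: "bilinear_map scale t \<gamma>"
  shows "lift2 t \<gamma> (\<Delta> (x * y)) =
    lift2 t (\<lambda>a b. lift2 t (\<lambda>c d. \<gamma> (a * c) (b * d)) (\<Delta> y)) (\<Delta> x)"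
proof -
  have L: "Vector_Spaces.linear fscale t (lift2 t \<gamma>)" using t by (rule linear_lift2)
  have "lift2 t \<gamma> (\<Delta> (x * y)) = lift2 t \<gamma> (tensor_mult (\<Delta> x) (\<Delta> y))"
    using t \<gamma> comult_mult by (rule lift2_tensor_eq)
  then show ?thesis
    by (simp add: tensor_mult_def linear_comp_lift2[OF L] t)
qed

lemma bilinear_map_functionals:
  assumes "functional f" "functional g"
  shows "bilinear_map scale (*) (\<lambda>a b. f a * g b)"
proof -
  show ?thesis
    using assms by (simp add: bilinear_map_def functional_add functional_scale distrib_left distrib_right mult_ac)
qed

lemma bilinear_map_mult:
  assumes "Vector_Spaces.linear scale scale f" "Vector_Spaces.linear scale scale g"
  shows "bilinear_map scale scale (\<lambda>a b. f a * g b)"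
proof -
  interpret f: Vector_Spaces.linear scale scale f by fact
  interpret g: Vector_Spaces.linear scale scale g by fact
  show ?thesis
    by (simp add: bilinear_map_def f.add f.scale g.add g.scale distrib_left distrib_right
        scale_mult_left scale_mult_right)
qed

lemma functional_mult_right:
  assumes "functional f"
  shows "functional (\<lambda>a. f (a * y))"
proof -
  show ?thesis
    using assms by (simp add: Vector_Spaces.linear_iff vector_space_axioms vector_space_field
        distrib_left distrib_right scale_mult_left)
qed

lemma functional_mult_left:
  assumes "functional f"
  shows "functional (\<lambda>y. f (a * y))"
proof -
  show ?thesis
    using assms by (simp add: Vector_Spaces.linear_iff vector_space_axioms vector_space_field
        distrib_left distrib_right scale_mult_right)
qed

lemma counit_word: "\<epsilon> (word w) = (if w = [] then 1 else 0)"
  using iso by (simp add: tensor_coalgebra_iso_def word_def pure_tensor_def lookup_single when_def)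

lemma word_homogeneous:
  assumes "list_all2 (\<lambda>x n. x \<in> compV n) w ns"
  shows "word w \<in> comp (sum_list ns)"
proof -
  have "pure_tensor w \<in> V.tensor_comp (sum_list ns)"
    unfolding V.tensor_comp_def using assms by (blast intro: formal.span_base)
  then show ?thesis using iso unfolding tensor_coalgebra_iso_def word_def by blast
qed

lemma one_neq_zero: "(1 :: 'h) \<noteq> 0"
  using counit_one functional_zero[OF counit_linear] by auto

lemma comp_0: "comp 0 = span {1}"
proof -
  obtain B where B: "B \<subseteq> comp 0" "independent B" "comp 0 \<subseteq> span B" "card B = dim (comp 0)"
    by (rule basis_exists)
  then obtain b where b: "B = {b}" using connected card_1_singletonE by metis
  then obtain c where c: "1 = scale c b" using B one_graded by (auto simp: span_singleton)
  then have "c \<noteq> 0" using one_neq_zero by auto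
  then have "b = scale (inverse c) 1" unfolding c by simp
  then have "span B \<subseteq> span {1}"
    using b by (intro span_minimal subspace_span) (auto simp: span_singleton)
  moreover have "span {1} \<subseteq> comp 0" using one_graded subspace_comp by (intro span_minimal) auto
  ultimately show ?thesis using B by blast
qed

text \<open>
  The empty word has degree zero and counit one, and by connectedness the unit is the only such
  element.
\<close>

lemma word_Nil [simp]: "word [] = 1"
proof -
  have "word [] \<in> comp 0" using word_homogeneous[of "[]" "[]"] by simp
  then obtain c where c: "word [] = scale c 1" by (auto simp: comp_0 span_singleton)
  then have "c = 1" using counit_word[of "[]"] by (simp add: functional_scale[OF counit_linear] counit_one)
  then show ?thesis using c by simp
qed

lemma antipode_left_word: "split_sum (\<lambda>p q. S (word p) * word q) w = (if w = [] then 1 else 0)"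
proof -
  have "split_sum (\<lambda>p q. S (word p) * word q) w = scale (\<epsilon> (word w)) 1"
    using lift2_comult_word[OF vector_space_axioms bilinear_map_mult[OF antipode_linear linear_ident], of w]
      antipode_left[of "word w"] by simp
  then show ?thesis by (simp add: counit_word)
qed

lemma antipode_right_word: "split_sum (\<lambda>p q. word p * S (word q)) w = (if w = [] then 1 else 0)"
proof -
  have "split_sum (\<lambda>p q. word p * S (word q)) w = scale (\<epsilon> (word w)) 1"
    using lift2_comult_word[OF vector_space_axioms bilinear_map_mult[OF linear_ident antipode_linear], of w]
      antipode_right[of "word w"] by simp
  then show ?thesis by (simp add: counit_word)
qed

text \<open>
  The convolution product on the dual of \<open>H\<close>, that is, the transpose of \<open>\<Delta>\<close>. Pairing with
  functionals replaces identities in \<open>H \<otimes> H\<close>, which hold only up to \<open>tensor_eq\<close>, by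
  equations between scalars.
\<close>

definition conv :: "('h \<Rightarrow> 'k) \<Rightarrow> ('h \<Rightarrow> 'k) \<Rightarrow> 'h \<Rightarrow> 'k"
  where "conv f g x = lift2 (*) (\<lambda>a b. f a * g b) (\<Delta> x)"

lemma functional_conv: "functional f \<Longrightarrow> functional g \<Longrightarrow> functional (conv f g)"
  unfolding conv_def[abs_def]
  by (intro linear_lift2_of_comult vector_space_field bilinear_map_functionals)

lemma conv_word:
  "functional f \<Longrightarrow> functional g \<Longrightarrow>
    conv f g (word w) = split_sum (\<lambda>p q. f (word p) * g (word q)) w"
  unfolding conv_def by (intro lift2_comult_word vector_space_field bilinear_map_functionals)

lemma conv_one: "functional f \<Longrightarrow> functional g \<Longrightarrow> conv f g 1 = f 1 * g 1"
  using conv_word[of f g "[]"] by simp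

text \<open>
  The compatibility of \<open>\<Delta>\<close> with products, for a right factor that is a word. The multipliers \<open>y\<close>
  and \<open>z\<close> stand for a right multiplication by \<open>y \<otimes> z\<close> in \<open>H \<otimes> H\<close>.
\<close>

lemma conv_mult_word:
  assumes f: "functional f" and g: "functional g"
  shows "conv (\<lambda>a. f (a * y)) (\<lambda>b. g (b * z)) (x * word w)
    = split_sum (\<lambda>p q. conv (\<lambda>a. f (a * (word p * y))) (\<lambda>b. g (b * (word q * z))) x) w"
proof -
  let ?f = "\<lambda>a. f (a * y)" and ?g = "\<lambda>b. g (b * z)"
  have fg: "functional ?f" "functional ?g" using f g functional_mult_right by blast+
  have inner: "lift2 (*) (\<lambda>c d. ?f (a * c) * ?g (b * d)) (\<Delta> (word w))
      = split_sum (\<lambda>p q. ?f (a * word p) * ?g (b * word q)) w" for a b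
    using fg
    by (intro lift2_comult_word vector_space_field bilinear_map_functionals functional_mult_left)
  have "conv ?f ?g (x * word w)
      = lift2 (*) (\<lambda>a b. split_sum (\<lambda>p q. ?f (a * word p) * ?g (b * word q)) w) (\<Delta> x)"
    unfolding conv_def
      lift2_comult_mult[OF vector_space_field bilinear_map_functionals[OF fg]] inner ..
  also have "\<dots> = split_sum (\<lambda>p q. lift2 (*) (\<lambda>a b. ?f (a * word p) * ?g (b * word q)) (\<Delta> x)) w"
    by (rule lift2_split_sum) (rule vector_space_field)
  finally show ?thesis by (simp add: conv_def mult.assoc)
qed

lemma linear_conv_right:
  assumes g: "functional g"
  shows "functional (\<lambda>z. conv f (\<lambda>b. g (b * z)) x)"
  unfolding conv_def
proof (rule linear_lift2_parameter[OF vector_space_axioms vector_space_field])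
  fix a b
  show "functional (\<lambda>z. f a * g (b * z))"
    using assms by (simp add: Vector_Spaces.linear_iff vector_space_axioms vector_space_field
        distrib_left scale_mult_right mult.left_commute)
qed

lemma linear_conv_left:
  assumes f: "functional f"
  shows "functional (\<lambda>y. conv (\<lambda>a. f (a * y)) g x)"
  unfolding conv_def
proof (rule linear_lift2_parameter[OF vector_space_axioms vector_space_field])
  fix a b
  show "functional (\<lambda>y. f (a * y) * g b)"
    using assms by (simp add: Vector_Spaces.linear_iff vector_space_axioms vector_space_field
        distrib_left distrib_right scale_mult_right mult.assoc)
qed

text \<open>
  The antipode reverses coproducts, in dual form. The usual argument is that \<open>\<Delta> \<circ> S\<close> is a left and
  \<open>\<tau> \<circ> (S \<otimes> S) \<circ> \<Delta>\<close> a right convolution inverse of \<open>\<Delta>\<close> in \<open>Hom(H, H \<otimes> H)\<close>, where \<open>\<tau>\<close> exchanges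
  the two factors, so that the two maps coincide. The quantity \<open>E\<close> below is the
  pairing of \<open>f \<otimes> g\<close> with the threefold convolution of these maps, in Sweedler notation
  \<open>\<Delta>(S(x\<^sub>1)) \<Delta>(x\<^sub>2) (S(x\<^sub>4) \<otimes> S(x\<^sub>3))\<close>, and it is evaluated by associating in the two
  possible ways.
\<close>

lemma conv_antipode:
  assumes f: "functional f" and g: "functional g"
  shows "conv f g (S (word w)) = split_sum (\<lambda>p q. g (S (word p)) * f (S (word q))) w"
proof -
  define \<Gamma> where "\<Gamma> y z x = conv (\<lambda>a. f (a * y)) (\<lambda>b. g (b * z)) x" for y z x
  have \<Gamma>_left: "functional (\<lambda>z. \<Gamma> y z x)" for y x
    unfolding \<Gamma>_def using g by (rule linear_conv_right)
  have \<Gamma>_arg: "functional (\<Gamma> y z)" for y z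
    unfolding \<Gamma>_def[abs_def] using f g by (intro functional_conv functional_mult_right)
  have \<Gamma>_one: "\<Gamma> y z 1 = f y * g z" for y z
    unfolding \<Gamma>_def using f g by (simp add: conv_one functional_mult_right)
  have \<Gamma>_mult: "\<Gamma> y z (x * word q) = split_sum (\<lambda>q1 q2. \<Gamma> (word q1 * y) (word q2 * z) x) q" for x y z q
    unfolding \<Gamma>_def using f g by (rule conv_mult_word)
  define E where "E = split_sum (\<lambda>p v. split_sum (\<lambda>q v'.
      split_sum (\<lambda>r s. \<Gamma> (S (word s)) (S (word r)) (S (word p) * word q)) v') v) w"
  have zero_left: "\<Gamma> y 0 x = 0" for y x
    using functional_zero[OF \<Gamma>_left] .
  have zero_arg: "\<Gamma> y z 0 = 0" for y z
    using functional_zero[OF \<Gamma>_arg] .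
  \<comment> \<open>The right inverse: with \<open>v = q\<^sub>1 q\<^sub>2 r s\<close>, the antipode identity removes first the middle
    pair \<open>q\<^sub>2, r\<close> and then the outer pair \<open>q\<^sub>1, s\<close>.\<close>
  have cancel_right: "split_sum (\<lambda>q v'. split_sum (\<lambda>r s. \<Gamma> (S (word s)) (S (word r)) (x * word q)) v') v
      = (if v = [] then \<Gamma> 1 1 x else 0)" for x v
  proof -
    have "split_sum (\<lambda>q v'. split_sum (\<lambda>r s. \<Gamma> (S (word s)) (S (word r)) (x * word q)) v') v
        = split_sum (\<lambda>q v'. split_sum (\<lambda>q1 q2. split_sum (\<lambda>r s.
            \<Gamma> (word q1 * S (word s)) (word q2 * S (word r)) x) v') q) v"
      unfolding \<Gamma>_mult by (subst split_sum_swap) (rule refl)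
    also have "\<dots> = split_sum (\<lambda>q1 u. split_sum (\<lambda>q2 v'. split_sum (\<lambda>r s.
            \<Gamma> (word q1 * S (word s)) (word q2 * S (word r)) x) v') u) v"
      by (rule split_sum_assoc[symmetric])
    also have "\<dots> = split_sum (\<lambda>q1 u. split_sum (\<lambda>m s. split_sum (\<lambda>q2 r.
            \<Gamma> (word q1 * S (word s)) (word q2 * S (word r)) x) m) u) v"
      by (subst split_sum_assoc) (rule refl)
    also have "\<dots> = split_sum (\<lambda>q1 u. split_sum (\<lambda>m s.
            \<Gamma> (word q1 * S (word s)) (if m = [] then 1 else 0) x) u) v"
      by (simp add: linear_split_sum[OF \<Gamma>_left, symmetric] antipode_right_word)
    also have "\<dots> = split_sum (\<lambda>q1 u. split_sum (\<lambda>m s.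
            if m = [] then \<Gamma> (word q1 * S (word s)) 1 x else 0) u) v"
      by (intro split_sum_cong) (simp add: zero_left)
    also have "\<dots> = split_sum (\<lambda>q1 u. \<Gamma> (word q1 * S (word u)) 1 x) v"
      by (subst split_sum_left_Nil) (rule refl)
    also have "\<dots> = (if v = [] then \<Gamma> 1 1 x else 0)"
    proof -
      have lin: "functional (\<lambda>y. \<Gamma> y 1 x)"
        unfolding \<Gamma>_def using f by (rule linear_conv_left)
      have "split_sum (\<lambda>q1 u. \<Gamma> (word q1 * S (word u)) 1 x) v
          = \<Gamma> (split_sum (\<lambda>q1 u. word q1 * S (word u)) v) 1 x"
        using linear_split_sum[OF lin, symmetric] by fast
      then show ?thesis using functional_zero[OF lin] by (simp only: antipode_right_word) simp
    qed
    finally show ?thesis .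
  qed
  have "E = split_sum (\<lambda>p v. if v = [] then \<Gamma> 1 1 (S (word p)) else 0) w"
    unfolding E_def by (intro split_sum_cong cancel_right)
  then have "\<Gamma> 1 1 (S (word w)) = E"
    by (simp add: split_sum_right_Nil)
  \<comment> \<open>The left inverse: associating the other way lets the antipode identity remove \<open>p, q\<close>.\<close>
  also have "E = split_sum (\<lambda>u v. split_sum (\<lambda>p q. split_sum (\<lambda>r s.
      \<Gamma> (S (word s)) (S (word r)) (S (word p) * word q)) v) u) w"
    unfolding E_def by (rule split_sum_assoc)
  also have "\<dots> = split_sum (\<lambda>u v. split_sum (\<lambda>r s. split_sum (\<lambda>p q.
      \<Gamma> (S (word s)) (S (word r)) (S (word p) * word q)) u) v) w"
    by (subst split_sum_swap) (rule refl)
  also have "\<dots> = split_sum (\<lambda>u v. split_sum (\<lambda>r s.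
      \<Gamma> (S (word s)) (S (word r)) (if u = [] then 1 else 0)) v) w"
    by (simp add: linear_split_sum[OF \<Gamma>_arg, symmetric] antipode_left_word)
  also have "\<dots> = split_sum (\<lambda>u v. if u = [] then
      split_sum (\<lambda>r s. \<Gamma> (S (word s)) (S (word r)) 1) v else 0) w"
    by (rule split_sum_cong) (simp add: zero_arg)
  also have "\<dots> = split_sum (\<lambda>r s. \<Gamma> (S (word s)) (S (word r)) 1) w"
    by (rule split_sum_left_Nil)
  finally have "\<Gamma> 1 1 (S (word w)) = split_sum (\<lambda>r s. \<Gamma> (S (word s)) (S (word r)) 1) w" .
  then show ?thesis by (simp add: \<Gamma>_one) (simp add: \<Gamma>_def mult.commute)
qed

section \<open>The leading term of the antipode\<close>

text \<open>
  The functional \<open>\<phi>\<^sub>1 \<otimes> \<cdots> \<otimes> \<phi>\<^sub>k\<close> transported to \<open>H\<close>. The choice of a preimage is immaterial for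
  linear \<open>\<phi>\<^sub>i\<close>, because such functionals respect \<open>tensor_eq\<close>.
\<close>

definition coord :: "('v \<Rightarrow> 'k) list \<Rightarrow> 'h \<Rightarrow> 'k"
  where "coord \<phi>s x = linear_extension (*) (tensor_functional \<phi>s) (SOME p. \<Phi> p = x)"

abbreviation functionalV :: "('v \<Rightarrow> 'k) \<Rightarrow> bool"
  where "functionalV \<phi> \<equiv> Vector_Spaces.linear scaleV (*) \<phi>"

lemma coord_Phi:
  assumes "\<forall>\<phi>\<in>set \<phi>s. functionalV \<phi>"
  shows "coord \<phi>s (\<Phi> p) = linear_extension (*) (tensor_functional \<phi>s) p"
proof -
  have "\<Phi> (SOME q. \<Phi> q = \<Phi> p) = \<Phi> p" by (rule someI[of "\<lambda>q. \<Phi> q = \<Phi> p"]) (rule refl)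
  then have "tensor_eq scaleV (SOME q. \<Phi> q = \<Phi> p) p"
    using iso unfolding tensor_coalgebra_iso_def by blast
  then show ?thesis
    unfolding coord_def
    using assms by (intro linear_extension_tensor_eq vector_space_field multilinear_tensor_functional)
qed

lemma coord_word:
  "\<forall>\<phi>\<in>set \<phi>s. functionalV \<phi> \<Longrightarrow> coord \<phi>s (word w) = tensor_functional \<phi>s w"
  by (simp add: word_def coord_Phi pure_tensor_def vector_space_field)

lemma functional_coord:
  assumes "\<forall>\<phi>\<in>set \<phi>s. functionalV \<phi>"
  shows "functional (coord \<phi>s)"
  unfolding Vector_Spaces.linear_iff
proof (intro conjI allI vector_space_field vector_space_axioms)
  note lin = linear_linear_extension[OF vector_space_field, of "tensor_functional \<phi>s",
      unfolded Vector_Spaces.linear_iff]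
  fix x y and c :: 'k
  obtain p q where pq: "x = \<Phi> p" "y = \<Phi> q" by (metis obtain_tensor)
  show "coord \<phi>s (x + y) = coord \<phi>s x + coord \<phi>s y"
    using assms lin by (simp add: pq Phi.add[symmetric] coord_Phi)
  show "coord \<phi>s (scale c x) = c * coord \<phi>s x"
    using assms lin by (simp add: pq Phi.scale[symmetric] coord_Phi)
qed

lemma coord_append:
  assumes "\<forall>\<phi>\<in>set \<phi>s. functionalV \<phi>" "\<forall>\<phi>\<in>set \<psi>s. functionalV \<phi>"
  shows "coord (\<phi>s @ \<psi>s) x = conv (coord \<phi>s) (coord \<psi>s) x"
proof (rule linear_eq_on_words[of "(*)"])
  show "functional (coord (\<phi>s @ \<psi>s))" "functional (conv (coord \<phi>s) (coord \<psi>s))"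
    using assms by (auto intro!: functional_conv functional_coord)
  show "coord (\<phi>s @ \<psi>s) (word w) = conv (coord \<phi>s) (coord \<psi>s) (word w)" for w
    using assms by (simp add: conv_word functional_coord coord_word ball_Un tensor_functional_append)
qed

lemma antipode_one [simp]: "S 1 = 1"
  using antipode_left_word[of "[]"] by simp

lemma antipode_letter: "S (word [x]) = - word [x]"
  using antipode_left_word[of "[x]"] by (simp add: split_sum_Cons add_eq_0_iff)

text \<open>
  The heart of the matter: modulo shorter words, \<open>S\<close> sends \<open>x\<^sub>1 \<cdots> x\<^sub>k\<close> to
  \<open>(-1)\<^sup>k x\<^sub>k \<cdots> x\<^sub>1\<close>. Splitting off the first functional and reversing the coproduct leaves a sum over
  the splittings of the word. A suffix that is empty contributes nothing, as \<open>S 1 = 1\<close> has no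
  letters, and by induction a prefix that is too short contributes nothing either. Only the
  splitting before the last letter survives, and \<open>S\<close> negates that letter.
\<close>

lemma coord_antipode_word:
  assumes "\<forall>\<phi>\<in>set \<phi>s. functionalV \<phi>" "length w \<le> length \<phi>s"
  shows "coord \<phi>s (S (word w))
    = (if length w = length \<phi>s then (-1) ^ length w * tensor_functional (rev \<phi>s) w else 0)"
  using assms
proof (induction \<phi>s arbitrary: w)
  case Nil
  then show ?case using coord_word[of "[]" "[]"] by simp
next
  case (Cons \<phi> \<phi>s)
  have lin: "\<forall>\<phi>\<in>set [\<phi>]. functionalV \<phi>" "\<forall>\<phi>\<in>set \<phi>s. functionalV \<phi>" using Cons.prems by auto
  note functionals = lin[THEN functional_coord]
  have "coord (\<phi> # \<phi>s) (S (word w)) = conv (coord [\<phi>]) (coord \<phi>s) (S (word w))"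
    using coord_append[OF lin] by simp
  also have "\<dots> = split_sum (\<lambda>p q. coord \<phi>s (S (word p)) * coord [\<phi>] (S (word q))) w"
    using functionals by (rule conv_antipode)
  finally have rec: "coord (\<phi> # \<phi>s) (S (word w))
      = split_sum (\<lambda>p q. coord \<phi>s (S (word p)) * coord [\<phi>] (S (word q))) w" .
  have one: "coord [\<phi>] 1 = 0" using coord_word[OF lin(1), of "[]"] by simp
  show ?case
  proof (cases w rule: rev_cases)
    case Nil
    then show ?thesis using rec one by simp
  next
    case (snoc u x)
    have "coord [\<phi>] (S (word [x])) = - \<phi> x"
      using coord_word[OF lin(1), of "[x]"] functional_scale[OF functionals(1), of "-1" "word [x]"]
      by (simp add: antipode_letter)
    then have "split_sum (\<lambda>p q. coord \<phi>s (S (word p)) * coord [\<phi>] (S (word (q @ [x])))) u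
        = split_sum (\<lambda>p q. if q = [] then coord \<phi>s (S (word p)) * (- \<phi> x) else 0) u"
      using Cons.IH[OF lin(2)] Cons.prems snoc by (intro split_sum_cong) auto
    then have "coord (\<phi> # \<phi>s) (S (word w)) = coord \<phi>s (S (word u)) * (- \<phi> x)"
      using rec one by (simp add: snoc split_sum_snoc split_sum_right_Nil)
    then show ?thesis
      using Cons.IH[OF lin(2), of u] Cons.prems by (simp add: snoc tensor_functional_snoc)
  qed
qed

section \<open>Words over a basis of the generating space\<close>

text \<open>
  A word is multilinear in its letters because \<open>\<Phi>\<close> identifies representatives of the same tensor.
\<close>

lemma linear_word_slot: "Vector_Spaces.linear scaleV scale (\<lambda>x. word (u @ [x] @ w))"
proof -
  have eq: "\<Phi> p = \<Phi> q" if "p - q \<in> multilinear_relations scaleV" for p q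
    using that iso unfolding tensor_coalgebra_iso_def tensor_eq_def
    by (blast intro: formal.span_base)
  show ?thesis
    unfolding Vector_Spaces.linear_iff
  proof (intro conjI allI vector_space_axioms V.vector_space_axioms)
    show "word (u @ [x + y] @ w) = word (u @ [x] @ w) + word (u @ [y] @ w)" for x y
      unfolding word_def Phi.add[symmetric]
      by (rule eq) (auto simp: multilinear_relations_def)
    show "word (u @ [scaleV c x] @ w) = scale c (word (u @ [x] @ w))" for c x
      unfolding word_def Phi.scale[symmetric]
      by (rule eq, unfold multilinear_relations_def, rule UnI2) blast
  qed
qed

lemma span_words:
  assumes v: "V.span (v ` I) = UNIV"
  shows "span ((\<lambda>w. word (map v w)) ` lists I) = UNIV"
proof -
  let ?W = "span ((\<lambda>w. word (map v w)) ` lists I)"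
  have words: "word (map v u @ w) \<in> ?W" if "u \<in> lists I" for u w
    using that
  proof (induction w arbitrary: u)
    case Nil
    then show ?case by (auto intro: span_base)
  next
    case (Cons x w)
    interpret L: Vector_Spaces.linear scaleV scale "\<lambda>y. word (map v u @ [y] @ w)"
      by (rule linear_word_slot)
    have "word (map v u @ [y] @ w) \<in> ?W" if "y \<in> v ` I" for y
      using that Cons.IH[of "u @ [i]" for i] Cons.prems by auto
    then have "V.span (v ` I) \<subseteq> {y. word (map v u @ [y] @ w) \<in> ?W}"
      by (intro V.span_minimal L.subspace_linear_preimage subspace_span) auto
    then show ?case using v by auto
  qed
  have "x \<in> ?W" for x
  proof -
    obtain p where "x = \<Phi> p" by (rule obtain_tensor)
    then have "x = linear_extension scale word p"
      using linear_eq_linear_extension[OF Phi.linear_axioms, of p] by (simp add: word_def[abs_def] pure_tensor_def)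
    then show ?thesis
      using words[of "[]"] by (auto simp: linear_extension_def intro!: span_sum span_scale)
  qed
  then show ?thesis by blast
qed

lemma representation_words:
  assumes lin: "\<And>a. a \<in> I \<Longrightarrow> functionalV (\<phi> a)"
    and dual: "\<And>a b. a \<in> I \<Longrightarrow> b \<in> I \<Longrightarrow> \<phi> a (v b) = (if a = b then 1 else 0)"
    and L: "L \<subseteq> lists I"
  shows "inj_on (\<lambda>w. word (map v w)) L" and "independent ((\<lambda>w. word (map v w)) ` L)"
    and "x \<in> span ((\<lambda>w. word (map v w)) ` L) \<Longrightarrow> w \<in> L \<Longrightarrow>
      representation ((\<lambda>w. word (map v w)) ` L) x (word (map v w)) = coord (map \<phi> w) x"
proof -
  have lin': "\<forall>f\<in>set (map \<phi> w). functionalV f" if "w \<in> L" for w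
    using that L lin by auto
  have 1: "functional (coord (map \<phi> w))" if "w \<in> L" for w
    using lin'[OF that] by (rule functional_coord)
  have 2: "coord (map \<phi> w) (word (map v u)) = (if w = u then 1 else 0)" if "w \<in> L" "u \<in> L" for w u
    using that L tensor_functional_map[of I \<phi> v w u] dual
    by (subst coord_word[OF lin']) blast+
  note * = representation_dual_family[of L "\<lambda>w. coord (map \<phi> w)" "\<lambda>w. word (map v w)"]
  show "inj_on (\<lambda>w. word (map v w)) L"
    using 1 2 by (rule *(1))
  show "independent ((\<lambda>w. word (map v w)) ` L)"
    using 1 2 by (rule *(2))
  show "x \<in> span ((\<lambda>w. word (map v w)) ` L) \<Longrightarrow> w \<in> L \<Longrightarrow>
      representation ((\<lambda>w. word (map v w)) ` L) x (word (map v w)) = coord (map \<phi> w) x"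
    using 1 2 by (rule *(3))
qed

text \<open>
  The expansion of an element in the words over some basis of \<open>V\<close> has coefficients given by the
  functionals \<open>coord\<close>.
\<close>

lemma coord_separating:
  assumes "\<And>\<phi>s. \<forall>\<phi>\<in>set \<phi>s. functionalV \<phi> \<Longrightarrow> coord \<phi>s x = 0"
  shows "x = 0"
proof -
  define B where "B = V.extend_basis {}"
  have B: "V.independent B" "V.span B = UNIV"
    unfolding B_def by (simp_all add: V.independent_extend_basis V.independent_empty)
  define \<phi> where "\<phi> b y = V.representation B y b" for b y
  let ?W = "(\<lambda>w. word (map (\<lambda>b. b) w)) ` lists B"
  have lin: "functionalV (\<phi> b)" for b
    unfolding \<phi>_def[abs_def] using B by (rule V.linear_representation)
  have dual: "\<phi> a b = (if a = b then 1 else 0)" if "a \<in> B" "b \<in> B" for a b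
    using B that by (simp add: \<phi>_def V.representation_basis)
  have rep: "representation ?W x (word (map (\<lambda>b. b) w)) = 0" if "w \<in> lists B" for w
    using representation_words(3)[of B \<phi> "\<lambda>b. b", OF lin dual order_refl _ that] span_words[of "\<lambda>b. b" B] B assms lin
    by auto
  have "x = (\<Sum>b | representation ?W x b \<noteq> 0. scale (representation ?W x b) b)"
    using representation_words(2)[of B \<phi> "\<lambda>b. b", OF lin dual order_refl] span_words[of "\<lambda>b. b" B] B
    by (simp add: sum_nonzero_representation_eq)
  also have "\<dots> = 0"
    using rep representation_ne_zero[of ?W x] by (intro sum.neutral) force
  finally show ?thesis .
qed

section \<open>Primitive elements\<close>

lemma word_letter_primitive: "word [x] \<in> primitives"
  using comult_word[of "[x]"] by (simp add: primitives_def split_sum_Cons)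

lemma conv_primitive:
  assumes x: "x \<in> primitives" and f: "functional f" and g: "functional g"
  shows "conv f g x = f 1 * g x + f x * g 1"
proof -
  interpret L: Vector_Spaces.linear fscale "(*)" "lift2 (*) (\<lambda>a b. f a * g b)"
    by (rule linear_lift2) (rule vector_space_field)
  have "conv f g x = lift2 (*) (\<lambda>a b. f a * g b) (pure_tensor [1, x] + pure_tensor [x, 1])"
    unfolding conv_def using x f g
    by (intro lift2_tensor_eq[OF vector_space_field bilinear_map_functionals[OF f g]])
      (auto simp: primitives_def)
  then show ?thesis by (simp add: L.add vector_space_field)
qed

lemma counit_primitive:
  assumes "x \<in> primitives"
  shows "\<epsilon> x = 0"
proof -
  have "bilinear_map scale scale (\<lambda>a b. scale (\<epsilon> a) b)"
    using counit_linear
    by (simp add: bilinear_map_def functional_add functional_scale scale_left_distrib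
        scale_right_distrib mult.commute)
  then have "x = lift2 scale (\<lambda>a b. scale (\<epsilon> a) b) (pure_tensor [1, x] + pure_tensor [x, 1])"
    using lift2_tensor_eq[OF vector_space_axioms, of scale] assms counit_left[of x]
    by (metis (mono_tags, lifting) mem_Collect_eq primitives_def)
  also have "\<dots> = scale (\<epsilon> 1) x + scale (\<epsilon> x) 1"
    using linear_lift2[OF vector_space_axioms, of "\<lambda>a b. scale (\<epsilon> a) b"]
    unfolding Vector_Spaces.linear_iff by (simp add: vector_space_axioms)
  finally show ?thesis using one_neq_zero by (simp add: counit_one)
qed

text \<open>
  Primitive elements pair to zero with convolution products of functionals that vanish at \<open>1\<close>, so
  they have no component of length two or more. The component of length zero vanishes because
  \<open>coord []\<close> is idempotent for convolution and takes the value one at \<open>1\<close>: it doubles on a primitive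
  element. What remains is \<open>v\<close>, the component of length one.
\<close>

lemma primitive_is_letter:
  assumes x: "x \<in> primitives"
  obtains v where "x = word [v]"
proof -
  obtain p where p: "x = \<Phi> p" by (rule obtain_tensor)
  define v where "v = linear_extension scaleV (\<lambda>w. case w of [y] \<Rightarrow> y | _ \<Rightarrow> 0) p"
  have "x - word [v] = 0"
  proof (rule coord_separating)
    fix \<phi>s :: "('v \<Rightarrow> 'k) list" assume lin: "\<forall>\<phi>\<in>set \<phi>s. functionalV \<phi>"
    have "coord \<phi>s x = coord \<phi>s (word [v])"
    proof (cases "length \<phi>s = 1")
      case True
      then obtain \<phi> where \<phi>: "\<phi>s = [\<phi>]" by (auto simp: length_Suc_conv)
      have \<phi>_lin: "functionalV \<phi>" using lin \<phi> by simp
      have "tensor_functional [\<phi>] = (\<lambda>w. \<phi> (case w of [y] \<Rightarrow> y | _ \<Rightarrow> 0))"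
      proof
        fix w
        have "\<phi> 0 = 0"
          using \<phi>_lin unfolding Vector_Spaces.linear_iff by (metis V.scale_zero_left mult_zero_left)
        then show "tensor_functional [\<phi>] w = \<phi> (case w of [y] \<Rightarrow> y | _ \<Rightarrow> 0)"
          by (auto split: list.split)
      qed
      then have "coord \<phi>s x = \<phi> v"
        using lin \<phi> by (simp add: p v_def coord_Phi linear_comp_linear_extension[OF \<phi>_lin])
      then show ?thesis using lin \<phi> by (simp add: coord_word)
    next
      case False
      have "coord \<phi>s y = 0" if y: "y \<in> primitives" for y
      proof (cases \<phi>s)
        case Nil
        have "coord [] y = conv (coord []) (coord []) y" using coord_append[of "[]" "[]"] by simp
        also have "\<dots> = coord [] y + coord [] y"
          using coord_word[of "[]" "[]"] by (simp add: conv_primitive y functional_coord)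
        finally show ?thesis using Nil by (simp only: add_cancel_right_right)
      next
        case (Cons \<phi> \<psi>s)
        have "\<psi>s \<noteq> []" using Cons False by auto
        have lin': "\<forall>\<phi>\<in>set [\<phi>]. functionalV \<phi>" "\<forall>\<phi>\<in>set \<psi>s. functionalV \<phi>" using lin Cons by auto
        have "coord [\<phi>] 1 = 0" "coord \<psi>s 1 = 0"
          using coord_word[OF lin'(1), of "[]"] coord_word[OF lin'(2), of "[]"] \<open>\<psi>s \<noteq> []\<close>
          by (simp_all add: tensor_functional_length)
        then show ?thesis
          using coord_append[OF lin', of y] conv_primitive[OF y lin'[THEN functional_coord]] Cons by simp
      qed
      then show ?thesis using x word_letter_primitive by simp
    qed
    then show "coord \<phi>s (x - word [v]) = 0"
      using functional_add[OF functional_coord[OF lin], of "x - word [v]" "word [v]"] by simp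
  qed
  then show ?thesis using that by simp
qed

lemma word_letter_inject:
  assumes "word [x] = word [y]"
  shows "x = y"
proof -
  have "tensor_eq scaleV (pure_tensor [x]) (pure_tensor [y])"
    using assms iso unfolding word_def tensor_coalgebra_iso_def by blast
  moreover have "multilinear scaleV scaleV (\<lambda>w. case w of [y] \<Rightarrow> y | _ \<Rightarrow> 0)"
    unfolding multilinear_def
    by (auto simp: Cons_eq_append_conv append_eq_Cons_conv split: list.splits)
  ultimately show ?thesis
    using linear_extension_tensor_eq[OF V.vector_space_axioms]
    by (fastforce simp: pure_tensor_def V.vector_space_axioms)
qed

text \<open>
  The degree on \<open>H\<close> and the degree on \<open>V\<close> agree on letters because \<open>\<Phi>\<close> is graded and the
  decomposition of \<open>H\<close> is direct.
\<close>

lemma homogeneous_primitive_is_homogeneous_letter: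
  assumes "x \<in> primitives" "x \<in> comp n"
  obtains v where "v \<in> compV n" "x = word [v]"
proof -
  obtain u where u: "x = word [u]" using primitive_is_letter assms by blast
  obtain c where c: "finite {i. c i \<noteq> 0}" "\<And>i. c i \<in> compV i" "u = (\<Sum>i | c i \<noteq> 0. c i)"
    using V.direct_sum[of u] by blast
  interpret L: Vector_Spaces.linear scaleV scale "\<lambda>x. word [x]"
    using linear_word_slot[of "[]" "[]"] by simp
  have "x = (\<Sum>i | c i \<noteq> 0. word [c i])" using u c by (simp add: L.sum)
  moreover have "word [c i] \<in> comp i" for i
    using word_homogeneous[of "[c i]" "[i]"] c by simp
  ultimately have "x = (if n \<in> {i. c i \<noteq> 0} then word [c n] else 0)"
    using assms c by (intro homogeneous_sum_component) auto
  then have "x = word [c n]" using L.zero by (auto split: if_splits)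
  then show ?thesis using that c by blast
qed

section \<open>The trace of the antipode\<close>

lemma word_map_homogeneous:
  assumes "\<And>a. a \<in> A \<Longrightarrow> v a \<in> compV (wt a)" "u \<in> lists A"
  shows "word (map v u) \<in> comp (sum_list (map wt u))"
  using assms by (intro word_homogeneous) (auto simp: list_all2_conv_all_nth)

text \<open>
  The antipode identity expresses the antipode of a word through the antipodes of its proper
  prefixes, so induction on the length shows that \<open>S\<close> preserves the grading.
\<close>

lemma antipode_word_homogeneous:
  assumes v: "\<And>a. a \<in> A \<Longrightarrow> v a \<in> compV (wt a)" and w: "w \<in> lists A"
  shows "S (word (map v w)) \<in> comp (sum_list (map wt w))"
  using w
proof (induction w rule: length_induct)
  case (1 w)
  have words: "word (map v u) \<in> comp (sum_list (map wt u))" if "u \<in> lists A" for u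
    using v that by (rule word_map_homogeneous)
  show ?case
  proof (cases w rule: rev_cases)
    case Nil
    then show ?thesis using one_graded by simp
  next
    case (snoc u a)
    have "split_sum (\<lambda>p q. S (word (map v p)) * word (map v q)) w = 0"
      using antipode_left_word[of "map v w"] snoc by (simp add: split_sum_map del: map_append)
    then have "S (word (map v w))
        = - split_sum (\<lambda>p q. S (word (map v p)) * word (map v (q @ [a]))) u"
      by (simp add: snoc split_sum_snoc add_eq_0_iff2)
    moreover have "S (word (map v (take i u))) * word (map v (drop i u @ [a])) \<in> comp (sum_list (map wt w))" for i
    proof -
      have "take i u \<in> lists A" "drop i u @ [a] \<in> lists A"
        using "1.prems" snoc by (auto dest: in_set_takeD in_set_dropD)
      moreover have "sum_list (map wt (take i u)) + sum_list (map wt (drop i u @ [a])) = sum_list (map wt w)"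
        by (simp add: snoc) (metis append_take_drop_id map_append sum_list_append)
      moreover have "length (take i u) < length w" by (simp add: snoc)
      ultimately show ?thesis
        using mult_graded[OF "1.IH"[rule_format, of "take i u"] words[of "drop i u @ [a]"]]
        by simp
    qed
    ultimately show ?thesis
      by (simp only: split_sum_def) (intro subspace_neg subspace_sum subspace_comp)
  qed
qed

lemma span_words_of_weight:
  assumes v: "\<And>a. a \<in> A \<Longrightarrow> v a \<in> compV (wt a)" and spanV: "V.span (v ` A) = UNIV"
  shows "span ((\<lambda>w. word (map v w)) ` {w \<in> lists A. sum_list (map wt w) = m}) = comp m"
proof
  let ?b = "\<lambda>w. word (map v w)" and ?wt = "\<lambda>w. sum_list (map wt w)"
  have words: "?b u \<in> comp (?wt u)" if "u \<in> lists A" for u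
    using v that by (rule word_map_homogeneous)
  then show "span (?b ` {w \<in> lists A. ?wt w = m}) \<subseteq> comp m"
    using subspace_comp by (intro span_minimal) auto
  show "comp m \<subseteq> span (?b ` {w \<in> lists A. ?wt w = m})"
  proof
    fix x assume x: "x \<in> comp m"
    have "x \<in> span (?b ` lists A)" using span_words[OF spanV] by simp
    then obtain T r where T: "finite T" "T \<subseteq> ?b ` lists A" "x = (\<Sum>y\<in>T. scale (r y) y)"
      unfolding span_explicit by blast
    define u where "u = inv_into (lists A) ?b"
    have u: "u y \<in> lists A" "?b (u y) = y" if "y \<in> T" for y
      using that T(2) inv_into_into[of y ?b "lists A"] f_inv_into_f[of y ?b "lists A"]
      by (auto simp: u_def)
    define g where "g n = (\<Sum>y | y \<in> T \<and> ?wt (u y) = n. scale (r y) y)" for n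
    have "x = (\<Sum>n\<in>(\<lambda>y. ?wt (u y)) ` T. g n)"
      unfolding g_def T(3) using T(1) by (rule sum.image_gen)
    moreover have "g n \<in> comp n" for n
    proof -
      have "y \<in> comp n" if "y \<in> T" "?wt (u y) = n" for y
        using words[OF u(1)[OF that(1)]] u(2)[OF that(1)] that(2) by simp
      then show ?thesis
        unfolding g_def by (intro subspace_sum subspace_scale subspace_comp) auto
    qed
    ultimately have "x = g m \<or> x = 0"
      using homogeneous_sum_component[OF _ _ x, of "(\<lambda>y. ?wt (u y)) ` T" g] T(1)
      by (auto split: if_splits)
    moreover have "g m \<in> span (?b ` {w \<in> lists A. ?wt w = m})"
      unfolding g_def
    proof (intro span_sum span_scale span_base)
      fix y assume "y \<in> {y \<in> T. ?wt (u y) = m}"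
      then show "y \<in> ?b ` {w \<in> lists A. ?wt w = m}"
        using u[of y] by (intro image_eqI[of _ _ "u y"]) auto
    qed
    ultimately show "x \<in> span (?b ` {w \<in> lists A. ?wt w = m})" using span_zero by auto
  qed
qed

text \<open>
  The words of weight \<open>m\<close> in the letters of \<open>A\<close> form a basis of \<open>H\<^sub>m\<close>; in particular there are
  finitely many. By \<open>coord_antipode_word\<close> the diagonal entry of \<open>S\<close> at such a word \<open>w\<close> is \<open>(-1)\<^sup>k\<close>
  times the coefficient of \<open>w\<close> at its own reversal, where \<open>k\<close> is the length of \<open>w\<close>.
\<close>

theorem trace_antipode:
  assumes findim: "finite_dim_components"
    and A: "homogeneous_basis primitives A"
    and wt: "\<And>a. a \<in> A \<Longrightarrow> a \<in> comp (wt a)"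
  shows "finite {w \<in> lists A. sum_list (map wt w) = m}"
    and "trace_on (comp m) S = (\<Sum>w \<in> palindromes A wt m. (-1) ^ length w)"
proof -
  have indA: "independent A" and spanA: "span A = primitives"
    using A by (auto simp: homogeneous_basis_def)
  have "\<exists>x. x \<in> compV (wt a) \<and> a = word [x]" if "a \<in> A" for a
    using that wt spanA span_base homogeneous_primitive_is_homogeneous_letter by metis
  then obtain v where v: "\<And>a. a \<in> A \<Longrightarrow> v a \<in> compV (wt a)" "\<And>a. a \<in> A \<Longrightarrow> word [v a] = a"
    by metis
  interpret L: Vector_Spaces.linear scaleV scale "\<lambda>x. word [x]"
    using linear_word_slot[of "[]" "[]"] by simp
  have spanV: "V.span (v ` A) = UNIV"
  proof -
    have "x \<in> V.span (v ` A)" for x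
    proof -
      have "(\<lambda>x. word [x]) ` v ` A = A" using v(2) by force
      then have "word [x] \<in> (\<lambda>x. word [x]) ` V.span (v ` A)"
        unfolding L.span_image[symmetric] using spanA word_letter_primitive by simp
      then show ?thesis using word_letter_inject by blast
    qed
    then show ?thesis by blast
  qed
  \<comment> \<open>The coordinates on \<open>V\<close> are pulled back from those of the primitive elements, so that words can
    be indexed directly by lists over \<open>A\<close>.\<close>
  define \<phi> where "\<phi> a x = representation A (word [x]) a" for a x
  have lin: "functionalV (\<phi> a)" for a
    unfolding Vector_Spaces.linear_iff \<phi>_def
    using indA spanA word_letter_primitive
    by (simp add: V.vector_space_axioms vector_space_field L.add L.scale representation_add
        representation_scale)
  have dual: "\<phi> a (v b) = (if a = b then 1 else 0)" if "a \<in> A" "b \<in> A" for a b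
    using that v(2) indA by (simp add: \<phi>_def representation_basis)
  let ?b = "\<lambda>w. word (map v w)"
  define T where "T = {w \<in> lists A. sum_list (map wt w) = m}"
  have TA: "T \<subseteq> lists A" by (auto simp: T_def)
  note basis = representation_words[of A \<phi> v, OF lin dual TA]
  have span_T: "span (?b ` T) = comp m"
    unfolding T_def using v(1) spanV by (rule span_words_of_weight)
  obtain F where F: "finite F" "span F = comp m"
    using findim unfolding finite_dim_components_def by blast
  have fin_bT: "finite (?b ` T)"
    using independent_span_bound[OF F(1) basis(2)] span_T F(2) span_superset[of "?b ` T"] by simp
  then have fin: "finite T" using basis(1) by (rule finite_imageD)
  then show "finite {w \<in> lists A. sum_list (map wt w) = m}" by (simp add: T_def)
  have S_T: "S (?b w) \<in> comp m" if "w \<in> T" for w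
    using antipode_word_homogeneous[of A v wt w] v(1) that by (auto simp: T_def)
  have S_inv: "S x \<in> comp m" if "x \<in> comp m" for x
  proof -
    have "span (?b ` T) \<subseteq> {x. S x \<in> comp m}"
      using S_T by (intro span_minimal antipode.subspace_linear_preimage subspace_comp) auto
    then show ?thesis using that span_T by blast
  qed
  have "trace_on (comp m) S = (\<Sum>y\<in>?b ` T. representation (?b ` T) (S y) y)"
    using basis(2) fin_bT span_T antipode_linear S_inv by (rule trace_on_eq_sum_representation)
  also have "\<dots> = (\<Sum>w\<in>T. representation (?b ` T) (S (?b w)) (?b w))"
    using basis(1) by (simp add: sum.reindex)
  also have "\<dots> = (\<Sum>w\<in>T. if rev w = w then (-1) ^ length w else 0)"
  proof (rule sum.cong[OF refl])
    fix w assume w: "w \<in> T"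
    then have wA: "w \<in> lists A" "rev w \<in> lists A" using TA by auto
    have "representation (?b ` T) (S (?b w)) (?b w) = coord (map \<phi> w) (S (?b w))"
      using S_T[OF w] span_T w by (intro basis(3)) auto
    also have "\<dots> = (-1) ^ length w * tensor_functional (map \<phi> (rev w)) (map v w)"
      using lin by (subst coord_antipode_word) (auto simp: rev_map)
    also have "\<dots> = (if rev w = w then (-1) ^ length w else 0)"
      using tensor_functional_map[of A \<phi> v, OF dual wA(2) wA(1)] by simp
    finally show "representation (?b ` T) (S (?b w)) (?b w) = (if rev w = w then (-1) ^ length w else 0)" .
  qed
  also have "\<dots> = (\<Sum>w \<in> palindromes A wt m. (-1) ^ length w)"
    using fin by (auto simp: palindromes_def T_def sum.inter_filter[symmetric] intro!: sum.cong)
  finally show "trace_on (comp m) S = (\<Sum>w \<in> palindromes A wt m. (-1) ^ length w)" .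
qed

text \<open>
  In degree zero there are only multiples of \<open>1\<close>, and among these only zero has counit zero.
\<close>

lemma weight_primitive_pos:
  assumes A: "homogeneous_basis primitives A" and "a \<in> A" "a \<in> comp n"
  shows "n > 0"
proof (rule ccontr)
  assume "\<not> n > 0"
  then obtain c where c: "a = scale c 1" using assms by (auto simp: comp_0 span_singleton)
  have "a \<in> primitives" using A \<open>a \<in> A\<close> span_base by (auto simp: homogeneous_basis_def)
  then have "a = 0"
    using c counit_primitive[of a] by (simp add: functional_scale[OF counit_linear] counit_one)
  then show False using A \<open>a \<in> A\<close> dependent_zero by (auto simp: homogeneous_basis_def)
qed

end

section \<open>Counting palindromes by length\<close>

lemma length_le_sum_list_map:
  assumes "\<And>a. a \<in> set w \<Longrightarrow> wt a > (0::nat)"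
  shows "length w \<le> sum_list (map wt w)"
  using assms by (induction w) (auto simp: Suc_le_eq add_strict_increasing)

lemma epal_minus_opal:
  assumes "finite (palindromes A wt m)"
  shows "of_int (int (epal A wt m) - int (opal A wt m))
    = (\<Sum>w\<in>palindromes A wt m. (-1) ^ length w :: 'a::ring_1)"
proof -
  let ?P = "palindromes A wt m"
  have "(\<Sum>w\<in>?P. (-1) ^ length w :: 'a)
      = (\<Sum>w | w \<in> ?P \<and> even (length w). (-1) ^ length w) + (\<Sum>w | w \<in> ?P \<and> odd (length w). (-1) ^ length w)"
    using assms by (subst sum.union_disjoint[symmetric]) (auto intro!: sum.cong)
  also have "\<dots> = of_int (int (epal A wt m) - int (opal A wt m))"
    by (simp add: epal_def opal_def)
  finally show ?thesis ..
qed

lemma sum_palindromes_by_length: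
  assumes fin: "finite (palindromes A wt m)" and pos: "\<And>a. a \<in> A \<Longrightarrow> wt a > 0"
  shows "(\<Sum>w\<in>palindromes A wt m. (-1) ^ length w) = (\<Sum>k=0..m. (-1) ^ k * int (pal A wt k m))"
proof -
  have "length ` palindromes A wt m \<subseteq> {0..m}"
    using length_le_sum_list_map[of _ wt] pos by (force simp: palindromes_def)
  then have "(\<Sum>w\<in>palindromes A wt m. (-1 :: int) ^ length w)
      = (\<Sum>k=0..m. \<Sum>w | w \<in> palindromes A wt m \<and> length w = k. (-1) ^ length w)"
    using fin by (subst sum.group) auto
  also have "\<dots> = (\<Sum>k=0..m. (-1) ^ k * int (pal A wt k m))"
    by (simp add: pal_def mult.commute)
  finally show ?thesis .
qed

theorem corollary22:
  fixes scale :: "'k::field_char_0 \<Rightarrow> 'h::ring_1 \<Rightarrow> 'h"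
    and H :: "nat \<Rightarrow> 'h set"
    and \<Delta> :: "'h \<Rightarrow> ('h list \<Rightarrow>\<^sub>0 'k)"
    and \<epsilon> :: "'h \<Rightarrow> 'k"
    and S :: "'h \<Rightarrow> 'h"
    and scaleV :: "'k \<Rightarrow> 'v::ab_group_add \<Rightarrow> 'v"
    and V :: "nat \<Rightarrow> 'v set"
    and A :: "'h set"
    and wt :: "'h \<Rightarrow> nat"
    and m :: nat
  assumes hopf: "graded_connected_hopf_algebra scale H \<Delta> \<epsilon> S"
    and findim: "graded_vector_space.finite_dim_components scale H"
    and cofree: "graded_coalgebra.cofree_on scale H \<Delta> \<epsilon> scaleV V"
    and alphabet: "graded_vector_space.homogeneous_basis scale H
      (graded_connected_hopf_algebra.primitives scale \<Delta>) A"
    and weight: "\<And>a. a \<in> A \<Longrightarrow> a \<in> H (wt a)"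
  shows "vector_space.trace_on scale (H m) S = of_int (int (epal A wt m) - int (opal A wt m))
    \<and> int (epal A wt m) - int (opal A wt m) = (\<Sum>k=0..m. (- 1) ^ k * int (pal A wt k m))"
proof -
  interpret H: graded_connected_hopf_algebra scale H \<Delta> \<epsilon> S by (rule hopf)
  obtain \<Phi> where \<Phi>: "graded_vector_space scaleV V" "H.tensor_coalgebra_iso scaleV V \<Phi>"
    using cofree unfolding H.cofree_on_def by blast
  interpret V: graded_vector_space scaleV V by (rule \<Phi>)
  interpret C: cofree_hopf_algebra scale H \<Delta> \<epsilon> S scaleV V \<Phi>
    by unfold_locales (rule \<Phi>)
  have "palindromes A wt m \<subseteq> {w \<in> lists A. sum_list (map wt w) = m}"
    by (auto simp: palindromes_def)
  then have fin: "finite (palindromes A wt m)"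
    using C.trace_antipode(1)[OF findim alphabet weight] finite_subset by blast
  have "wt a > 0" if "a \<in> A" for a
    using C.weight_primitive_pos[OF alphabet that weight[OF that]] .
  then have "int (epal A wt m) - int (opal A wt m) = (\<Sum>k=0..m. (- 1) ^ k * int (pal A wt k m))"
    using sum_palindromes_by_length[OF fin] epal_minus_opal[OF fin, where 'a = int] by simp
  moreover have "H.trace_on (H m) S = of_int (int (epal A wt m) - int (opal A wt m))"
    using C.trace_antipode(2)[OF findim alphabet weight] epal_minus_opal[OF fin, where 'a = 'k] by simp
  ultimately show ?thesis by blast
qed

end
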